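(* Let $A$ and $B$ be two antipodal vertices of the interchange graph $G(R,S)$ of a class ${\cal A}(R,S)$ of $m\times n$ $\{0,1\}$-matrices. Then $$0.25\,mn \;\leq\; i(A,B) \;\leq\; \frac{1+\sqrt{2}}{4+\sqrt{8}}\,mn\,(1+o(1)) \;\approx\; 0.354\,mn\,(1+o(1)),$$ where $i(A,B)$ is the distance between $A$ and $B$ in $G(R,S)$, and the $o(1)$ term denotes a function tending to zero as $\min\{m,n\}$ tends to infinity. (That is, the lower bound holds for all $m,n$, and for every $\epsilon>0$ there exists $M$ such that $i(A,B)\le \frac{1+\sqrt 2}{4+\sqrt 8}mn(1+\epsilon)$ for all such $A,B$ whenever $\min\{m,n\}\ge M$.)
   Context: Let $R=(r_1,\ldots,r_m)$ and $S=(s_1,\ldots,s_n)$ be non-negative integral vectors with $\sum r_i=\sum s_j$. Let ${\cal A}(R,S)$ denote the set of all $m\times n$ $\{0,1\}$-matrices with row sum vector $R$ and column sum vector $S$, and assume ${\cal A}(R,S)\neq\emptyset$. An interchange is a transformation which replaces a $2\times 2$ submatrix of a matrix that is equal to the identity matrix $\begin{pmatrix}1&0\\0&1\end{pmatrix}$ with the $2\times 2$ permutation matrix $\begin{pmatrix}0&1\\1&0\end{pmatrix}$. The interchange graph $G(R,S)$ is the undirected graph whose vertices are all matrices in ${\cal A}(R,S)$, where two matrices are adjacent provided that one of them can be obtained from the other by a single interchange. (By a theorem of Ryser, $G(R,S)$ is connected.) For $A,B\in{\cal A}(R,S)$, $i(A,B)$ denotes the distance between $A$ and $B$ in $G(R,S)$.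 Two matrices $A,B\in{\cal A}(R,S)$ are antipodal if $B$ is the complement of $A$, i.e. $A+B$ is the all-one matrix (necessarily all row sums are then $n/2$ and all column sums are $m/2$). *)

theory Defs
  imports
    Complex_Main
    "Jordan_Normal_Form.Matrix"
    "Graph_Theory.Pair_Digraph"
    "Graph_Theory.Shortest_Path"
begin

text \<open>
  The sizes \<open>m\<close> and \<open>n\<close> are the dimensions of the vectors \<open>R\<close> and \<open>S\<close>. Matrices and vectors have
  entries in \<^typ>\<open>nat\<close>, and indices start at \<open>0\<close>.
\<close>

definition matrix_class :: "nat vec \<Rightarrow> nat vec \<Rightarrow> nat mat set" where
  "matrix_class R S =
    {A \<in> carrier_mat (dim_vec R) (dim_vec S).
       elements_mat A \<subseteq> {0, 1} \<and>
       (\<forall>i < dim_vec R. (\<Sum>j < dim_vec S. A $$ (i, j)) = R $ i) \<and>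
       (\<forall>j < dim_vec S. (\<Sum>i < dim_vec R. A $$ (i, j)) = S $ j)}"

text \<open>
  \<open>B\<close> arises from \<open>A\<close> by replacing an identity submatrix, in rows \<open>i < i'\<close> and columns \<open>j < j'\<close>,
  by the other permutation matrix of order two. This relation is directed; the interchange graph
  is its symmetric closure.
\<close>

definition interchange :: "nat mat \<Rightarrow> nat mat \<Rightarrow> bool" where
  "interchange A B \<longleftrightarrow>
    (\<exists>i i' j j'. i < i' \<and> i' < dim_row A \<and> j < j' \<and> j' < dim_col A \<and>
       A $$ (i, j) = 1 \<and> A $$ (i, j') = 0 \<and> A $$ (i', j) = 0 \<and> A $$ (i', j') = 1 \<and>
       B = mat (dim_row A) (dim_col A) (\<lambda>(p, q).
             if (p, q) \<in> {(i, j), (i', j')} then 0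
             else if (p, q) \<in> {(i, j'), (i', j)} then 1
             else A $$ (p, q)))"

text \<open>As usual for \<^locale>\<open>pair_graph\<close>, an undirected edge is a pair of opposite arcs.\<close>

definition interchange_graph :: "nat vec \<Rightarrow> nat vec \<Rightarrow> nat mat pair_pre_digraph" where
  "interchange_graph R S =
    \<lparr>pverts = matrix_class R S,
     parcs = {(A, B). A \<in> matrix_class R S \<and> B \<in> matrix_class R S \<and>
                      (interchange A B \<or> interchange B A)}\<rparr>"

text \<open>The distance is the least length of a walk, and \<open>\<infinity>\<close> if there is no walk.\<close>

definition interchange_distance :: "nat vec \<Rightarrow> nat vec \<Rightarrow> nat mat \<Rightarrow> nat mat \<Rightarrow> ereal" where
  "interchange_distance R S = wf_digraph.\<mu> (with_proj (interchange_graph R S)) (\<lambda>_. 1)"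

definition antipodal :: "nat vec \<Rightarrow> nat vec \<Rightarrow> nat mat \<Rightarrow> nat mat \<Rightarrow> bool" where
  "antipodal R S A B \<longleftrightarrow>
    A \<in> matrix_class R S \<and> B \<in> matrix_class R S \<and>
    A + B = mat (dim_vec R) (dim_vec S) (\<lambda>_. 1)"

lemma finite_matrix_class: "finite (matrix_class R S)"
proof -
  let ?I = "{..<dim_vec R} \<times> {..<dim_vec S}"
  let ?f = "\<lambda>P. mat (dim_vec R) (dim_vec S) (\<lambda>x. if x \<in> P then 1 else 0 :: nat)"
  have "matrix_class R S \<subseteq> ?f ` Pow ?I"
  proof
    fix A assume A: "A \<in> matrix_class R S"
    then have dims: "dim_row A = dim_vec R" "dim_col A = dim_vec S"
      by (auto simp: matrix_class_def)
    have "A $$ (i, j) \<in> {0, 1}" if "i < dim_vec R" "j < dim_vec S" for i j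
      using A that elements_matI[of A "dim_vec R" "dim_vec S" i j "A $$ (i, j)"]
      by (auto simp: matrix_class_def)
    then have "A = ?f {x \<in> ?I. A $$ x = 1}"
      using dims by (intro eq_matI) auto
    then show "A \<in> ?f ` Pow ?I" by blast
  qed
  then show ?thesis by (rule finite_subset) auto
qed

lemma pair_graph_interchange_graph: "pair_graph (interchange_graph R S)"
proof -
  have fin: "finite (parcs (interchange_graph R S))"
    by (rule finite_subset[of _ "matrix_class R S \<times> matrix_class R S"])
       (auto simp: interchange_graph_def finite_matrix_class)
  have irrefl: "\<not> interchange A A" for A
  proof
    assume "interchange A A"
    then obtain i i' j j' where *: "i < i'" "i' < dim_row A" "j < j'" "j' < dim_col A"
      "A $$ (i, j) = 1" and eq: "A = mat (dim_row A) (dim_col A) (\<lambda>(p, q).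
             if (p, q) \<in> {(i, j), (i', j')} then 0
             else if (p, q) \<in> {(i, j'), (i', j)} then 1
             else A $$ (p, q))"
      unfolding interchange_def by blast
    have "A $$ (i, j) = 0" by (subst eq) (use * in auto)
    then show False using * by simp
  qed
  show ?thesis
    by unfold_locales
       (use fin irrefl in \<open>auto simp: interchange_graph_def finite_matrix_class
          symmetric_def arcs_ends_conv intro!: symI\<close>)
qed

end

theory Submission
  imports Defs "HOL-Library.Disjoint_Sets" "HOL-Library.FuncSet"
begin

text \<open>
  Call a matrix balanced if every row and every column has as many ones as zeros. The members of
  an antipodal pair \<open>A\<close>, \<open>B\<close> are balanced, and a submatrix of order two in which \<open>A\<close> is a
  permutation matrix is a directed 4-cycle of the orientation of the complete bipartite graph
  given by \<open>A\<close>.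

  An interchange changes four entries, and antipodal matrices differ in all \<open>m n\<close> entries; this is
  the lower bound.

  For the upper bound, suppose that \<open>A\<close> contains \<open>q\<close> such submatrices with pairwise disjoint sets of
  cells. One interchange in each of them leaves \<open>m n - 4 q\<close> differences from \<open>B\<close>, and by Ryser's
  argument \<open>d\<close> differences can be removed by at most \<open>d / 2\<close> interchanges
  (\<open>relpow_interchange_rel_of_packing\<close>). So the distance is at most \<open>m n / 2 - q\<close>.

  Balance yields many disjoint 4-cycles. For columns \<open>j\<close> and \<open>k\<close>, the number of rows with entries
  \<open>(1, 0)\<close> in these columns equals the number \<open>x\<close> of rows with entries \<open>(0, 1)\<close>, because both
  columns have the same sum. Therefore giving the weight \<open>2 / (n x)\<close> to each of the \<open>x\<^sup>2\<close> 4-cycles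
  on \<open>j\<close> and \<open>k\<close> puts total weight exactly one on every cell: a perfect fractional packing of
  weight \<open>m n / 4\<close>. It arises if each row matches its ones with its zeros uniformly at random,
  and rows that matched \<open>j\<close> with \<open>k\<close> in opposite directions are combined to 4-cycles.

  To make this integral, the columns are partitioned into groups of bounded size, about \<open>1000\<close>, in
  which most rows have nearly as many ones as zeros (\<open>ex_balanced_partition\<close>), and each row matches
  only within the groups. As there are boundedly many row patterns in a group, the rows of
  each pattern can be distributed evenly over the colours of a proper edge colouring, with a rounding
  error that is independent of the number of rows (\<open>ex_uniform_row_matchings\<close>). The result is a
  packing of \<open>3 m n / 20\<close> disjoint 4-cycles for large \<open>m\<close> and \<open>n\<close> (\<open>ex_four_cycle_packing\<close>). The
  distance is then at most \<open>7 m n / 20\<close>, and \<open>7 / 20 < 1 / sqrt 8 = (1 + sqrt 2) / (4 + sqrt 8)\<close>.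
\<close>

section \<open>Packings of 4-cycles from matchings in the rows\<close>

lemma ex_even_colouring:
  fixes X :: "'a set"
  assumes "finite X" "L > 0"
  shows "\<exists>f. \<forall>c<L. card X div L \<le> card {x \<in> X. f x = (c::nat)}"
proof -
  obtain h where h: "bij_betw h X {0..<card X}"
    using ex_bij_betw_finite_nat[OF assms(1)] by blast
  have "card X div L \<le> card {x \<in> X. h x mod L = c}" if c: "c < L" for c
  proof -
    let ?T = "(\<lambda>q. c + L * q) ` {..<card X div L}"
    have "c + L * q < card X" if "q < card X div L" for q
    proof -
      have "c + L * q < L * (q + 1)" using c by simp
      also have "\<dots> \<le> L * (card X div L)" using that by (intro mult_le_mono2) simp
      also have "\<dots> \<le> card X" by simp
      finally show ?thesis .
    qed
    then have T: "?T \<subseteq> h ` {x \<in> X. h x mod L = c}"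
    proof (intro subsetI, elim imageE)
      fix y q assume y: "y = c + L * q" and "q \<in> {..<card X div L}"
      then have "y \<in> {0..<card X}" using \<open>\<And>q. q < card X div L \<Longrightarrow> c + L * q < card X\<close> by simp
      then obtain x where "x \<in> X" "h x = y" 
        unfolding bij_betw_imp_surj_on[OF h, symmetric] by auto
      then show "y \<in> h ` {x \<in> X. h x mod L = c}"
        using c y by (intro image_eqI[of y h x]) auto
    qed
    have "inj_on (\<lambda>q. c + L * q) {..<card X div L}" using assms(2) by (simp add: inj_on_def)
    then have "card ?T = card X div L" by (simp add: card_image)
    then have "card X div L = card ?T" ..
    also have "\<dots> \<le> card (h ` {x \<in> X. h x mod L = c})"
      using T assms(1) by (intro card_mono) auto
    also have "\<dots> \<le> card {x \<in> X. h x mod L = c}"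
      using assms(1) by (intro card_image_le) auto
    finally show ?thesis .
  qed
  then show ?thesis by (intro exI[of _ "\<lambda>x. h x mod L"]) simp
qed

text \<open>
  A quadruple \<open>(i, i', j, j')\<close> stands for the submatrix in rows \<open>i\<close>, \<open>i'\<close> and columns \<open>j\<close>, \<open>j'\<close>,
  in any order. A 0-1-matrix is given by the predicate \<open>P\<close> that holds at the positions of the ones.
\<close>

fun cells :: "'a \<times> 'a \<times> 'b \<times> 'b \<Rightarrow> ('a \<times> 'b) set" where
  "cells (i, i', j, j') = {i, i'} \<times> {j, j'}"

text \<open>The submatrix is the identity matrix, if its rows and columns are listed in the given order.\<close>

fun four_cycle :: "('a \<Rightarrow> 'b \<Rightarrow> bool) \<Rightarrow> 'a \<times> 'a \<times> 'b \<times> 'b \<Rightarrow> bool" where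
  "four_cycle P (i, i', j, j') \<longleftrightarrow> P i j \<and> \<not> P i j' \<and> \<not> P i' j \<and> P i' j'"

text \<open>A set of 4-cycles with rows in \<open>I\<close>, columns in \<open>J\<close> and pairwise disjoint sets of cells.\<close>

definition four_cycle_packing ::
    "'a set \<Rightarrow> 'b set \<Rightarrow> ('a \<Rightarrow> 'b \<Rightarrow> bool) \<Rightarrow> ('a \<times> 'a \<times> 'b \<times> 'b) set \<Rightarrow> bool" where
  "four_cycle_packing I J P Q \<longleftrightarrow>
    finite Q \<and> (\<forall>q\<in>Q. four_cycle P q \<and> cells q \<subseteq> I \<times> J) \<and> disjoint_family_on cells Q"

text \<open>
  In each row \<open>i\<close>, let \<open>X i\<close> match some ones with zeros: \<open>X i j k\<close> says that the one in column \<open>j\<close> is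
  matched with the zero in column \<open>k\<close>. A row that matches \<open>j\<close> with \<open>k\<close> and a row that
  matches \<open>k\<close> with \<open>j\<close> form a 4-cycle. The sum counts every pair of columns twice.
\<close>

lemma four_cycle_packing_of_row_matchings:
  fixes J :: "'b::linorder set"
  assumes fin: "finite I" "finite J"
    and X: "\<And>i j k. X i j k \<Longrightarrow> i \<in> I \<and> j \<in> J \<and> k \<in> J \<and> P i j \<and> \<not> P i k"
    and uniq_right: "\<And>i j k l. X i j k \<Longrightarrow> X i j l \<Longrightarrow> k = l"
    and uniq_left: "\<And>i j k l. X i j l \<Longrightarrow> X i k l \<Longrightarrow> j = k"
  shows "\<exists>Q. four_cycle_packing I J P Q \<and>
    2 * card Q = (\<Sum>j\<in>J. \<Sum>k\<in>J. min (card {i. X i j k}) (card {i. X i k j}))"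
proof -
  define W where "W j k = card {i. X i j k}" for j k
  have finX: "finite {i. X i j k}" for j k
    by (rule finite_subset[OF _ fin(1)]) (use X in auto)
  have "\<exists>S f. S \<subseteq> {i. X i j k} \<and> card S = min (W j k) (W k j) \<and>
      inj_on f S \<and> f ` S \<subseteq> {i. X i k j}" for j k
  proof -
    obtain S where S: "S \<subseteq> {i. X i j k}" "card S = min (W j k) (W k j)"
      using obtain_subset_with_card_n[of "min (W j k) (W k j)" "{i. X i j k}"]
      by (auto simp: W_def)
    have "finite S" using S(1) finX by (rule finite_subset)
    moreover have "card S \<le> card {i. X i k j}" using S(2) by (simp add: W_def)
    ultimately obtain f where "f ` S \<subseteq> {i. X i k j}" "inj_on f S"
      using card_le_inj[of S "{i. X i k j}"] finX by auto
    then show ?thesis using S by blast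
  qed
  then obtain S f where S: "\<And>j k. S j k \<subseteq> {i. X i j k}"
      "\<And>j k. card (S j k) = min (W j k) (W k j)"
    and f: "\<And>j k. inj_on (f j k) (S j k)" "\<And>j k. f j k ` S j k \<subseteq> {i. X i k j}"
    by metis
  have finS: "finite (S j k)" for j k using S(1) finX by (rule finite_subset)
  define T where "T = {(j, k) \<in> J \<times> J. j < k}"
  have finT: "finite T" unfolding T_def by (rule finite_subset[of _ "J \<times> J"]) (use fin in auto)
  define F where "F = (\<lambda>((j, k), i). (i, f j k i, j, k))"
  define Q where "Q = F ` (SIGMA p:T. S (fst p) (snd p))"
  have injF: "inj_on F (SIGMA p:T. S (fst p) (snd p))"
    by (auto simp: F_def inj_on_def)
  have mem: "\<exists>i j k. q = (i, f j k i, j, k) \<and> i \<in> S j k \<and> j < k \<and> X i j k \<and> X (f j k i) k j"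
    if "q \<in> Q" for q
    using that S(1) f(2) unfolding Q_def F_def T_def by fastforce
  have "finite Q" unfolding Q_def using finT finS by auto
  moreover have "four_cycle P q \<and> cells q \<subseteq> I \<times> J" if "q \<in> Q" for q
    using mem[OF that] X by auto
  moreover have "disjoint_family_on cells Q"
  unfolding disjoint_family_on_def
  proof (intro ballI impI)
    fix q r assume q: "q \<in> Q" and r: "r \<in> Q" and ne: "q \<noteq> r"
    obtain i j k where qq: "q = (i, f j k i, j, k)" "i \<in> S j k" "j < k" "X i j k" "X (f j k i) k j"
      using mem[OF q] by blast
    obtain a b d where rr: "r = (a, f b d a, b, d)" "a \<in> S b d" "b < d" "X a b d" "X (f b d a) d b"
      using mem[OF r] by blast
    show "cells q \<inter> cells r = {}"
    proof (rule ccontr)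
      assume "cells q \<inter> cells r \<noteq> {}"
      then obtain x y where x: "x = i \<or> x = f j k i" "x = a \<or> x = f b d a"
        and y: "y = j \<or> y = k" "y = b \<or> y = d"
        using qq rr by auto
      \<comment> \<open>The matching of the common row pairs the common column with one column only.\<close>
      have "X x j k \<or> X x k j" "X x b d \<or> X x d b" using x qq rr by auto
      with y obtain z z' where z: "{j, k} = {y, z}" "X x y z \<or> X x z y"
        and z': "{b, d} = {y, z'}" "X x y z' \<or> X x z' y" by blast
      have "z = z'"
      proof (cases "P x y")
        case True
        then have "X x y z" "X x y z'" using z(2) z'(2) X by blast+
        then show ?thesis by (rule uniq_right)
      next
        case False
        then have "X x z y" "X x z' y" using z(2) z'(2) X by blast+
        then show ?thesis by (rule uniq_left)
      qed
      then have "{j, k} = {b, d}" using z(1) z'(1) by simp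
      then have jk: "j = b \<and> k = d" using qq(3) rr(3) by (auto simp: doubleton_eq_iff)
      have "i = a"
      proof (cases "X x j k")
        case True
        then have "\<not> X x k j" using X by blast
        then show ?thesis using x qq rr jk by auto
      next
        case False
        then have "f j k i = f j k a" using x qq rr jk by auto
        then show ?thesis using f(1) qq(2) rr(2) jk by (auto dest: inj_onD)
      qed
      then show False using ne qq rr jk by simp
    qed
  qed
  moreover have "2 * card Q = (\<Sum>j\<in>J. \<Sum>k\<in>J. min (W j k) (W k j))"
  proof -
    let ?h = "\<lambda>(j, k). min (W j k) (W k j)"
    have diag: "W j j = 0" for j
    proof -
      have "{i. X i j j} = {}" using X by blast
      then show ?thesis by (simp add: W_def)
    qed
    have "card Q = card (SIGMA p:T. S (fst p) (snd p))"
      unfolding Q_def using injF by (rule card_image)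
    also have "\<dots> = (\<Sum>p\<in>T. ?h p)"
      using finT finS by (subst card_SigmaI) (auto simp: S(2) case_prod_unfold)
    finally have 1: "card Q = (\<Sum>p\<in>T. ?h p)" .
    have 2: "(\<Sum>p\<in>prod.swap ` T. ?h p) = (\<Sum>p\<in>T. ?h p)"
      by (subst sum.reindex) (auto simp: case_prod_unfold min.commute)
    have disj: "T \<inter> prod.swap ` T = {}" by (auto simp: T_def)
    have "(\<Sum>p\<in>J \<times> J. ?h p) = (\<Sum>p\<in>T \<union> prod.swap ` T. ?h p)"
    proof (rule sum.mono_neutral_right)
      show "\<forall>p \<in> J \<times> J - (T \<union> prod.swap ` T). ?h p = 0"
      proof
        fix p assume p: "p \<in> J \<times> J - (T \<union> prod.swap ` T)"
        obtain j k where [simp]: "p = (j, k)" by (cases p)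
        have "(k, j) \<notin> T"
        proof
          assume "(k, j) \<in> T"
          then have "prod.swap (k, j) \<in> prod.swap ` T" by (rule imageI)
          then show False using p by simp
        qed
        then have "j = k" using p by (auto simp: T_def)
        then show "?h p = 0" by (simp add: diag)
      qed
    qed (use fin in \<open>auto simp: T_def\<close>)
    also have "\<dots> = (\<Sum>p\<in>T. ?h p) + (\<Sum>p\<in>prod.swap ` T. ?h p)"
      using finT disj by (intro sum.union_disjoint) auto
    finally show ?thesis using 1 2 by (simp add: sum.cartesian_product)
  qed
  ultimately show ?thesis unfolding four_cycle_packing_def W_def by blast
qed

text \<open>
  The integral version of uniformly random matchings within a group \<open>g\<close> of columns. For every pattern
  of ones and zeros in \<open>g\<close> with at most \<open>L\<close> of each, the complete bipartite graph
  between the ones and the zeros is properly edge coloured with \<open>L\<close> colours, by adding ranks modulo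
  \<open>L\<close>. Each row uses the matching of one colour, and the rows with the same pattern are distributed
  evenly over the colours. There are at most \<open>2 ^ card g\<close> patterns, and for each of them less than
  \<open>L\<close> rows are lost by rounding.
\<close>

lemma ex_uniform_row_matchings:
  fixes P :: "'a \<Rightarrow> 'b \<Rightarrow> bool"
  assumes fin: "finite I" "finite g" and L: "L > 0"
  defines "good i \<equiv> card {j \<in> g. P i j} \<le> L \<and> card {j \<in> g. \<not> P i j} \<le> L"
  shows "\<exists>X. (\<forall>i j k. X i j k \<longrightarrow> i \<in> I \<and> j \<in> g \<and> k \<in> g \<and> P i j \<and> \<not> P i k) \<and>
    (\<forall>i j k l. X i j k \<longrightarrow> X i j l \<longrightarrow> k = l) \<and> (\<forall>i j k l. X i j l \<longrightarrow> X i k l \<longrightarrow> j = k) \<and>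
    (\<forall>j\<in>g. \<forall>k\<in>g. card {i \<in> I. good i \<and> P i j \<and> \<not> P i k}
                     \<le> L * (card {i. X i j k} + 2 ^ card g))"
proof -
  have "\<exists>h. finite S \<longrightarrow> bij_betw h S {0..<card S}" for S :: "'b set"
    using ex_bij_betw_finite_nat by blast
  then obtain rk :: "'b set \<Rightarrow> 'b \<Rightarrow> nat"
    where rk: "\<And>S. finite S \<Longrightarrow> bij_betw (rk S) S {0..<card S}" by metis
  define pat where "pat i = {j \<in> g. P i j}" for i
  have "\<exists>f. \<forall>\<pi>. \<forall>c<L. card {i \<in> I. pat i = \<pi>} div L
      \<le> card {i \<in> {i \<in> I. pat i = \<pi>}. f \<pi> i = c}"
    by (intro choice allI ex_even_colouring) (use fin L in auto)
  then obtain f where f: "\<And>\<pi> c. c < L \<Longrightarrow>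
      card {i \<in> I. pat i = \<pi>} div L \<le> card {i \<in> {i \<in> I. pat i = \<pi>}. f \<pi> i = c}" by blast
  define col where "col \<pi> j k = (rk \<pi> j + rk (g - \<pi>) k) mod L" for \<pi> j k
  define X where "X i j k \<longleftrightarrow> i \<in> I \<and> good i \<and> j \<in> g \<and> k \<in> g \<and> P i j \<and> \<not> P i k \<and>
      f (pat i) i = col (pat i) j k" for i j k
  have compl: "g - pat i = {j \<in> g. \<not> P i j}" for i by (auto simp: pat_def)
  have fin_pat: "finite (pat i)" "finite (g - pat i)" for i using fin by (auto simp: pat_def)
  have rk_less: "rk (pat i) j < L" if "good i" "j \<in> pat i" for i j
  proof -
    have "rk (pat i) j < card (pat i)"
      using rk[OF fin_pat(1)] that(2) by (force simp: bij_betw_def)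
    then show ?thesis using that(1) by (simp add: good_def pat_def)
  qed
  have rk_less': "rk (g - pat i) j < L" if "good i" "j \<in> g - pat i" for i j
  proof -
    have "rk (g - pat i) j < card (g - pat i)"
      using rk[OF fin_pat(2)] that(2) by (force simp: bij_betw_def)
    then show ?thesis using that(1) by (simp add: good_def compl)
  qed
  have cancel: "b = b'" if "(a + b) mod L = (a + b') mod L" "b < L" "b' < L" for a b b' :: nat
  proof -
    have eq: "x = y" if "x \<le> y" "(a + x) mod L = (a + y) mod L" "y < L" for x y
    proof -
      have "L dvd (a + y) - (a + x)" using that mod_eq_dvd_iff_nat[of "a + x" "a + y" L] by simp
      then have "L dvd y - x" by simp
      moreover have "y - x < L" using that(3) by simp
      ultimately have "y - x = 0" using dvd_imp_le[of L "y - x"] by (cases "y - x = 0") auto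
      then show ?thesis using that(1) by simp
    qed
    show ?thesis using that eq[of b b'] eq[of b' b] by (cases "b \<le> b'") auto
  qed
  have X_entry: "i \<in> I \<and> j \<in> g \<and> k \<in> g \<and> P i j \<and> \<not> P i k" if "X i j k" for i j k
    using that by (simp add: X_def)
  have X_mem: "good i" "j \<in> pat i" "k \<in> g - pat i" if "X i j k" for i j k
    using that by (auto simp: X_def pat_def)
  have inj: "inj_on (rk (pat i)) (pat i)" "inj_on (rk (g - pat i)) (g - pat i)" for i
    using rk fin_pat bij_betw_imp_inj_on by blast+
  have "k = l" if X: "X i j k" "X i j l" for i j k l
  proof -
    have "(rk (pat i) j + rk (g - pat i) k) mod L = (rk (pat i) j + rk (g - pat i) l) mod L"
      using X by (simp add: X_def col_def)
    then have "rk (g - pat i) k = rk (g - pat i) l"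
      by (rule cancel) (use X X_mem rk_less' in blast)+
    then show ?thesis using inj_onD[OF inj(2)[of i]] X X_mem by blast
  qed
  moreover have "j = k" if X: "X i j l" "X i k l" for i j k l
  proof -
    have "(rk (g - pat i) l + rk (pat i) j) mod L = (rk (g - pat i) l + rk (pat i) k) mod L"
      using X by (simp add: X_def col_def add.commute)
    then have "rk (pat i) j = rk (pat i) k"
      by (rule cancel) (use X X_mem rk_less in blast)+
    then show ?thesis using inj_onD[OF inj(1)[of i]] X X_mem by blast
  qed
  moreover have "card {i \<in> I. good i \<and> P i j \<and> \<not> P i k} \<le> L * (card {i. X i j k} + 2 ^ card g)"
    if jk: "j \<in> g" "k \<in> g" for j k
  proof -
    define PS where "PS = {\<pi> \<in> Pow g. card \<pi> \<le> L \<and> card (g - \<pi>) \<le> L \<and> j \<in> \<pi> \<and> k \<notin> \<pi>}"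
    have finPS: "finite PS" using fin by (auto simp: PS_def)
    have cardPS: "card PS \<le> 2 ^ card g"
      using fin by (subst card_Pow[symmetric]) (auto simp: PS_def intro!: card_mono)
    have good_iff: "good i \<longleftrightarrow> card (pat i) \<le> L \<and> card (g - pat i) \<le> L" for i
      by (simp add: good_def pat_def compl[unfolded pat_def])
    have PS_iff: "pat i \<in> PS \<longleftrightarrow> good i \<and> P i j \<and> \<not> P i k" for i
    proof -
      have "pat i \<subseteq> g" "j \<in> pat i \<longleftrightarrow> P i j" "k \<in> pat i \<longleftrightarrow> P i k"
        using jk by (auto simp: pat_def)
      then show ?thesis by (simp add: PS_def good_iff)
    qed
    have "{i \<in> I. good i \<and> P i j \<and> \<not> P i k} = (\<Union>\<pi>\<in>PS. {i \<in> I. pat i = \<pi>})"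
      using PS_iff by blast
    then have "card {i \<in> I. good i \<and> P i j \<and> \<not> P i k} \<le> (\<Sum>\<pi>\<in>PS. card {i \<in> I. pat i = \<pi>})"
      using card_UN_le[OF finPS] by simp
    also have "\<dots> \<le> (\<Sum>\<pi>\<in>PS. L * card {i \<in> I. pat i = \<pi> \<and> f \<pi> i = col \<pi> j k} + L)"
    proof (rule sum_mono)
      fix \<pi>
      have "col \<pi> j k < L" using L by (simp add: col_def)
      from f[OF this, of \<pi>] have "card {i \<in> I. pat i = \<pi>} div L
          \<le> card {i \<in> I. pat i = \<pi> \<and> f \<pi> i = col \<pi> j k}" by (simp add: conj_assoc)
      then have "L * (card {i \<in> I. pat i = \<pi>} div L)
          \<le> L * card {i \<in> I. pat i = \<pi> \<and> f \<pi> i = col \<pi> j k}" by simp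
      moreover have "card {i \<in> I. pat i = \<pi>}
          = L * (card {i \<in> I. pat i = \<pi>} div L) + card {i \<in> I. pat i = \<pi>} mod L" by simp
      moreover have "card {i \<in> I. pat i = \<pi>} mod L < L" using L by simp
      ultimately show "card {i \<in> I. pat i = \<pi>}
          \<le> L * card {i \<in> I. pat i = \<pi> \<and> f \<pi> i = col \<pi> j k} + L" by linarith
    qed
    also have "\<dots> = L * ((\<Sum>\<pi>\<in>PS. card {i \<in> I. pat i = \<pi> \<and> f \<pi> i = col \<pi> j k}) + card PS)"
      by (simp add: sum.distrib sum_distrib_left algebra_simps)
    also have "(\<Sum>\<pi>\<in>PS. card {i \<in> I. pat i = \<pi> \<and> f \<pi> i = col \<pi> j k})
        = card (\<Union>\<pi>\<in>PS. {i \<in> I. pat i = \<pi> \<and> f \<pi> i = col \<pi> j k})"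
      using finPS fin by (subst card_UN_disjoint) auto
    also have "(\<Union>\<pi>\<in>PS. {i \<in> I. pat i = \<pi> \<and> f \<pi> i = col \<pi> j k}) = {i. X i j k}"
      using jk PS_iff unfolding X_def by blast
    finally show ?thesis using cardPS by (meson add_left_mono le_trans mult_le_mono2)
  qed
  ultimately show ?thesis using X_entry by (intro exI[of _ X]) blast
qed

section \<open>Partitions into balanced groups\<close>

text \<open>
  The partition \<open>c\<close> minimises the sum of \<open>B j k\<close> over all pairs within the same part. Moving \<open>j\<close> to
  another part does not decrease it; averaging this over all \<open>G\<close> parts gives the bound.
\<close>

lemma ex_balanced_partition:
  fixes B :: "'b \<Rightarrow> 'b \<Rightarrow> real"
  assumes J: "finite J" and G: "G > (0::nat)"
    and sym: "\<And>j k. j \<in> J \<Longrightarrow> k \<in> J \<Longrightarrow> B j k = B k j"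
    and diag: "\<And>j. j \<in> J \<Longrightarrow> B j j = \<beta>" and "\<beta> \<ge> 0"
    and row: "\<And>j. j \<in> J \<Longrightarrow> (\<Sum>k\<in>J. B j k) = s"
  shows "\<exists>c. c ` J \<subseteq> {..<G} \<and> (\<forall>j\<in>J. (\<Sum>k\<in>{k \<in> J. c k = c j}. B j k) \<le> \<beta> + s / real G)"
proof -
  define \<Phi> where "\<Phi> c = (\<Sum>j\<in>J. \<Sum>k\<in>J. if c k = c j then B j k else 0)" for c :: "'b \<Rightarrow> nat"
  define \<C> where "\<C> = J \<rightarrow>\<^sub>E {..<G}"
  have "finite \<C>" "\<C> \<noteq> {}" using J G by (auto simp: \<C>_def finite_PiE PiE_eq_empty_iff)
  then obtain c where c: "c \<in> \<C>" and min: "\<And>c'. c' \<in> \<C> \<Longrightarrow> \<Phi> c \<le> \<Phi> c'"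
    using arg_min_if_finite(1) arg_min_least by metis
  have "(\<Sum>k\<in>{k \<in> J. c k = c j}. B j k) \<le> \<beta> + s / real G" if j: "j \<in> J" for j
  proof -
    define J' where "J' = J - {j}"
    have J': "finite J'" "J = insert j J'" "j \<notin> J'" using J j by (auto simp: J'_def)
    define e where "e h = (\<Sum>k\<in>J'. if c k = h then B j k else 0)" for h
    define rest where "rest = (\<Sum>i\<in>J'. \<Sum>k\<in>J'. if c k = c i then B i k else 0)"
    have split: "\<Phi> (c(j := h)) = B j j + 2 * e h + rest" for h
    proof -
      have 1: "(\<Sum>k\<in>J'. if (c(j := h)) k = h then B j k else 0) = e h"
        unfolding e_def using J'(3) by (intro sum.cong) auto
      have 2: "(\<Sum>k\<in>J'. if h = (c(j := h)) k then B k j else 0) = e h"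
        unfolding e_def using J' sym by (intro sum.cong) auto
      have 3: "(\<Sum>i\<in>J'. \<Sum>k\<in>J'. if (c(j := h)) k = (c(j := h)) i then B i k else 0) = rest"
        unfolding rest_def using J'(3) by (intro sum.cong) auto
      show ?thesis unfolding \<Phi>_def using J' 1 2 3
        by (simp add: sum.distrib fun_upd_same del: fun_upd_apply)
    qed
    have "e (c j) \<le> e h" if "h < G" for h
    proof -
      have "c(j := h) \<in> \<C>" using c j that by (auto simp: \<C>_def PiE_def extensional_def)
      from min[OF this] split[of h] split[of "c j"] show ?thesis by simp
    qed
    then have "(\<Sum>h<G. e (c j)) \<le> (\<Sum>h<G. e h)" by (intro sum_mono) auto
    also have "\<dots> = (\<Sum>k\<in>J'. \<Sum>h<G. if c k = h then B j k else 0)"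
      unfolding e_def by (rule sum.swap)
    also have "\<dots> = (\<Sum>k\<in>J'. B j k)"
      using c J' by (intro sum.cong) (auto simp: \<C>_def)
    also have "\<dots> = s - \<beta>" using row[OF j] diag[OF j] J' by simp
    finally have "real G * e (c j) \<le> s" using \<open>\<beta> \<ge> 0\<close> by simp
    then have "e (c j) \<le> s / real G" using G by (simp add: field_simps)
    moreover have "(\<Sum>k\<in>{k \<in> J. c k = c j}. B j k) = \<beta> + e (c j)"
    proof -
      have "{k \<in> J. c k = c j} = insert j {k \<in> J'. c k = c j}" using J' by auto
      then show ?thesis using J' diag[OF j] by (simp add: e_def sum.If_cases Int_def)
    qed
    ultimately show ?thesis by simp
  qed
  then show ?thesis using c by (intro exI[of _ c]) (auto simp: \<C>_def)
qed

section \<open>Packings in balanced matrices\<close>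

text \<open>
  Ones count \<open>1\<close> and zeros \<open>-1\<close>, so the sum over a set of columns is the imbalance of a row there.
\<close>

definition sgn_entry :: "('a \<Rightarrow> 'b \<Rightarrow> bool) \<Rightarrow> 'a \<Rightarrow> 'b \<Rightarrow> real" where
  "sgn_entry P i j = (if P i j then 1 else - 1)"

lemma sum_sgn_entry_row:
  assumes "finite J"
  shows "(\<Sum>j\<in>J. sgn_entry P i j) = real (card {j \<in> J. P i j}) - real (card {j \<in> J. \<not> P i j})"
  using assms by (simp add: sgn_entry_def sum.If_cases Int_def conj_commute)

text \<open>Every row and every column has as many ones as zeros.\<close>

definition balanced :: "'a set \<Rightarrow> 'b set \<Rightarrow> ('a \<Rightarrow> 'b \<Rightarrow> bool) \<Rightarrow> bool" where
  "balanced I J P \<longleftrightarrow>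
    (\<forall>i\<in>I. (\<Sum>j\<in>J. sgn_entry P i j) = 0) \<and> (\<forall>j\<in>J. (\<Sum>i\<in>I. sgn_entry P i j) = 0)"

text \<open>
  A partition of the columns into \<open>G\<close> groups of size at most \<open>s\<close> gives a packing whose size is
  controlled by the imbalances \<open>D i h\<close> of the rows \<open>i\<close> in the groups \<open>h\<close>. If all
  imbalances vanish, then each row contributes \<open>k\<^sup>2 / 4\<close> for a group of size \<open>k\<close>. The term with
  \<open>(D i h)\<^sup>2\<close> also pays, as in Chebyshev's inequality, for the rows that have more than \<open>L\<close> ones or
  more than \<open>L\<close> zeros in a group, because their imbalance is at least \<open>2 L - s\<close>. The last term is the
  rounding error.
\<close>

lemma four_cycle_packing_of_partition:
  fixes J :: "'b::linorder set" and c :: "'b \<Rightarrow> nat"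
  assumes fin: "finite I" "finite J" and bal: "balanced I J P"
    and c: "c ` J \<subseteq> {..<G}"
    and size: "\<And>h. h < G \<Longrightarrow> card {j \<in> J. c j = h} \<le> s"
    and L: "L > 0" "s < 2 * L"
  defines "D i h \<equiv> \<Sum>j\<in>{j \<in> J. c j = h}. sgn_entry P i j"
  shows "\<exists>Q. four_cycle_packing I J P Q \<and>
    (\<Sum>h<G. \<Sum>i\<in>I. (real (card {j \<in> J. c j = h}))\<^sup>2 / 4
        - (1 / 4 + (real s)\<^sup>2 / (2 * (2 * real L - real s)\<^sup>2)) * (D i h)\<^sup>2)
      - real L * 2 ^ s * real s * real (card J) \<le> 2 * real L * real (card Q)"
proof -
  define Jh where "Jh h = {j \<in> J. c j = h}" for h
  define u where "u = sgn_entry P"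
  define \<tau> where "\<tau> = 2 * real L - real s"
  define good where "good h i \<longleftrightarrow> card {j \<in> Jh h. P i j} \<le> L \<and> card {j \<in> Jh h. \<not> P i j} \<le> L" for h i
  have \<tau>: "\<tau> > 0" using L by (simp add: \<tau>_def)
  have finJh: "finite (Jh h)" for h using fin by (simp add: Jh_def)
  have size': "card (Jh h) \<le> s" if "h < G" for h using size[OF that] by (simp add: Jh_def)
  have "\<exists>X. \<forall>h. (\<forall>i j k. X h i j k \<longrightarrow> i \<in> I \<and> j \<in> Jh h \<and> k \<in> Jh h \<and> P i j \<and> \<not> P i k) \<and>
    (\<forall>i j k l. X h i j k \<longrightarrow> X h i j l \<longrightarrow> k = l) \<and> (\<forall>i j k l. X h i j l \<longrightarrow> X h i k l \<longrightarrow> j = k) \<and>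
    (\<forall>j\<in>Jh h. \<forall>k\<in>Jh h. card {i \<in> I. good h i \<and> P i j \<and> \<not> P i k}
                     \<le> L * (card {i. X h i j k} + 2 ^ card (Jh h)))"
    unfolding good_def
    by (intro choice allI ex_uniform_row_matchings) (use fin finJh L in auto)
  then obtain X where Xall: "\<forall>h. (\<forall>i j k. X h i j k \<longrightarrow> i \<in> I \<and> j \<in> Jh h \<and> k \<in> Jh h \<and> P i j \<and> \<not> P i k) \<and>
    (\<forall>i j k l. X h i j k \<longrightarrow> X h i j l \<longrightarrow> k = l) \<and> (\<forall>i j k l. X h i j l \<longrightarrow> X h i k l \<longrightarrow> j = k) \<and>
    (\<forall>j\<in>Jh h. \<forall>k\<in>Jh h. card {i \<in> I. good h i \<and> P i j \<and> \<not> P i k}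
                     \<le> L * (card {i. X h i j k} + 2 ^ card (Jh h)))" ..
  have X: "i \<in> I \<and> j \<in> Jh h \<and> k \<in> Jh h \<and> P i j \<and> \<not> P i k" if "X h i j k" for h i j k
    using spec[OF Xall, of h] that by blast
  have Xr: "k = l" if "X h i j k" "X h i j l" for h i j k l
    using spec[OF Xall, of h] that by blast
  have Xl: "j = k" if "X h i j l" "X h i k l" for h i j k l
    using spec[OF Xall, of h] that by blast
  have XW: "card {i \<in> I. good h i \<and> P i j \<and> \<not> P i k}
      \<le> L * (card {i. X h i j k} + 2 ^ card (Jh h))" if "j \<in> Jh h" "k \<in> Jh h" for h j k
    using spec[OF Xall, of h] that by blast
  define Y where "Y i j k \<longleftrightarrow> X (c j) i j k" for i j k
  have Yc: "i \<in> I \<and> j \<in> J \<and> k \<in> J \<and> P i j \<and> \<not> P i k \<and> c j = c k" if "Y i j k" for i j k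
    using X[OF that[unfolded Y_def]] by (auto simp: Jh_def)
  have Yl: "j = k" if "Y i j l" "Y i k l" for i j k l
  proof -
    have "c j = c k" using Yc[OF that(1)] Yc[OF that(2)] by simp
    then show ?thesis using that Xl unfolding Y_def by metis
  qed
  have "\<exists>Q. four_cycle_packing I J P Q \<and>
      2 * card Q = (\<Sum>j\<in>J. \<Sum>k\<in>J. min (card {i. Y i j k}) (card {i. Y i k j}))"
    by (rule four_cycle_packing_of_row_matchings[OF fin])
      (use Yc Yl Xr in \<open>unfold Y_def, blast+\<close>)
  then obtain Q where Q: "four_cycle_packing I J P Q"
      "2 * card Q = (\<Sum>j\<in>J. \<Sum>k\<in>J. min (card {i. Y i j k}) (card {i. Y i k j}))" by blast
  define bad where "bad h i = (if good h i then 0 else 1 :: real)" for h i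
  \<comment> \<open>Up to rounding, \<open>w h j k\<close> is a lower bound for \<open>L\<close> times the number of rows that match \<open>j\<close>
      with \<open>k\<close>. It is half the number of rows in which \<open>j\<close> and \<open>k\<close> differ, minus the
      number of those among them that are not good; so it is symmetric in \<open>j\<close> and \<open>k\<close>.\<close>
  define w where "w h j k = (\<Sum>i\<in>I. (1 / 4 - bad h i / 2) * (1 - u i j * u i k))" for h j k
  have w_sym: "w h j k = w h k j" for h j k by (simp add: w_def mult.commute)
  have W: "w (c j) j k - real L * 2 ^ s \<le> real L * real (card {i. Y i j k})"
    if jk: "j \<in> J" "k \<in> J" "c j = c k" for j k
  proof -
    define h where "h = c j"
    have h: "h < G" "j \<in> Jh h" "k \<in> Jh h" using jk c by (auto simp: h_def Jh_def)
    \<comment> \<open>The balance of the columns is what makes both directions between \<open>j\<close> and \<open>k\<close> equally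
        frequent.\<close>
    have zero: "(\<Sum>i\<in>I. u i j - u i k) = 0"
      using bal jk by (simp add: balanced_def u_def sum_subtractf)
    have "w h j k = w h j k + (\<Sum>i\<in>I. u i j - u i k) / 4" using zero by simp
    also have "\<dots> = (\<Sum>i\<in>I. (1 / 4 - bad h i / 2) * (1 - u i j * u i k) + (u i j - u i k) / 4)"
      by (simp add: w_def sum.distrib sum_divide_distrib)
    also have "\<dots> \<le> (\<Sum>i\<in>I. if good h i \<and> P i j \<and> \<not> P i k then 1 else 0)"
      by (intro sum_mono) (auto simp: bad_def u_def sgn_entry_def)
    also have "\<dots> = real (card {i \<in> I. good h i \<and> P i j \<and> \<not> P i k})"
      using fin by (simp add: sum.If_cases Int_def)
    also have "\<dots> \<le> real (L * (card {i. X h i j k} + 2 ^ card (Jh h)))"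
      using XW[OF h(2,3)] by (simp only: of_nat_le_iff)
    also have "\<dots> \<le> real (L * (card {i. X h i j k} + 2 ^ s))"
      using size'[OF h(1)] by (intro of_nat_mono mult_le_mono2 add_left_mono power_increasing) auto
    finally show ?thesis by (simp add: Y_def h_def algebra_simps)
  qed
  have min_ge: "w (c j) j k - real L * 2 ^ s
      \<le> real L * real (min (card {i. Y i j k}) (card {i. Y i k j}))"
    if "j \<in> J" "k \<in> J" "c j = c k" for j k
    using W[OF that] W[OF that(2,1) that(3)[symmetric]] that(3) w_sym by (auto simp: min_def)
  have wsum: "(\<Sum>j\<in>Jh h. \<Sum>k\<in>Jh h. w h j k)
      = (\<Sum>i\<in>I. (1 / 4 - bad h i / 2) * ((real (card (Jh h)))\<^sup>2 - (D i h)\<^sup>2))" for h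
  proof -
    have "(\<Sum>j\<in>Jh h. \<Sum>k\<in>Jh h. w h j k)
        = (\<Sum>j\<in>Jh h. \<Sum>i\<in>I. \<Sum>k\<in>Jh h. (1 / 4 - bad h i / 2) * (1 - u i j * u i k))"
      unfolding w_def by (intro sum.cong refl sum.swap)
    also have "\<dots> = (\<Sum>i\<in>I. \<Sum>j\<in>Jh h. \<Sum>k\<in>Jh h. (1 / 4 - bad h i / 2) * (1 - u i j * u i k))"
      by (rule sum.swap)
    also have "\<dots> = (\<Sum>i\<in>I. (1 / 4 - bad h i / 2) * ((real (card (Jh h)))\<^sup>2 - (D i h)\<^sup>2))"
    proof (intro sum.cong refl)
      fix i
      have "(\<Sum>j\<in>Jh h. \<Sum>k\<in>Jh h. 1 - u i j * u i k) = (real (card (Jh h)))\<^sup>2 - (D i h)\<^sup>2"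
        unfolding D_def u_def[symmetric] Jh_def[symmetric]
        by (simp add: sum_subtractf power2_eq_square sum_product)
      then show "(\<Sum>j\<in>Jh h. \<Sum>k\<in>Jh h. (1 / 4 - bad h i / 2) * (1 - u i j * u i k))
          = (1 / 4 - bad h i / 2) * ((real (card (Jh h)))\<^sup>2 - (D i h)\<^sup>2)"
        by (simp only: sum_distrib_left[symmetric])
    qed
    finally show ?thesis .
  qed
  have row_bound: "(real (card (Jh h)))\<^sup>2 / 4 - (1 / 4 + (real s)\<^sup>2 / (2 * \<tau>\<^sup>2)) * (D i h)\<^sup>2
      \<le> (1 / 4 - bad h i / 2) * ((real (card (Jh h)))\<^sup>2 - (D i h)\<^sup>2)" if h: "h < G" for h i
  proof (cases "good h i")
    case True
    have "0 \<le> (real s)\<^sup>2 / (2 * \<tau>\<^sup>2) * (D i h)\<^sup>2" by simp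
    then show ?thesis using True by (simp add: bad_def algebra_simps)
  next
    case False
    have "real (card (Jh h)) = real (card {j \<in> Jh h. P i j}) + real (card {j \<in> Jh h. \<not> P i j})"
      using finJh by (subst of_nat_add[symmetric], subst card_Un_disjoint[symmetric])
        (auto intro!: arg_cong[of _ _ card])
    moreover have "D i h = real (card {j \<in> Jh h. P i j}) - real (card {j \<in> Jh h. \<not> P i j})"
      unfolding D_def Jh_def[symmetric] using finJh by (rule sum_sgn_entry_row)
    moreover have "real (card (Jh h)) \<le> real s" using size'[OF h] by simp
    ultimately have "\<tau> \<le> \<bar>D i h\<bar>" using False by (auto simp: good_def \<tau>_def)
    then have "\<tau>\<^sup>2 \<le> (D i h)\<^sup>2" using \<tau> by (simp add: abs_le_square_iff[symmetric])
    then have "(real s)\<^sup>2 * 1 \<le> (real s)\<^sup>2 * ((D i h)\<^sup>2 / \<tau>\<^sup>2)"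
      using \<tau> by (intro mult_left_mono) auto
    moreover have "(real (card (Jh h)))\<^sup>2 \<le> (real s)\<^sup>2" using size'[OF h] by simp
    moreover have "(1 / 4 + (real s)\<^sup>2 / (2 * \<tau>\<^sup>2)) * (D i h)\<^sup>2
        = (D i h)\<^sup>2 / 4 + (real s)\<^sup>2 * ((D i h)\<^sup>2 / \<tau>\<^sup>2) / 2"
      by (simp add: algebra_simps)
    moreover have "a / 4 - (d / 4 + e / 2) \<le> (1 / 4 - 1 / 2) * (a - d)"
      if "b * 1 \<le> e" "a \<le> b" "0 \<le> d" for a b d e :: real using that by (simp add: field_simps)
    ultimately show ?thesis using False by (simp only: bad_def if_False zero_le_power2)
  qed
  have J_split: "(\<Sum>j\<in>J. f j) = (\<Sum>h<G. \<Sum>j\<in>Jh h. f j)" for f :: "'b \<Rightarrow> real"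
    unfolding Jh_def by (rule sum.group[symmetric]) (use fin c in auto)
  have "(\<Sum>h<G. \<Sum>i\<in>I. (real (card (Jh h)))\<^sup>2 / 4
        - (1 / 4 + (real s)\<^sup>2 / (2 * \<tau>\<^sup>2)) * (D i h)\<^sup>2) - real L * 2 ^ s * real s * real (card J)
      \<le> (\<Sum>h<G. \<Sum>j\<in>Jh h. \<Sum>k\<in>Jh h. w h j k) - (\<Sum>j\<in>J. real L * 2 ^ s * real s)"
    unfolding wsum by (intro diff_mono sum_mono row_bound) auto
  also have "\<dots> \<le> (\<Sum>h<G. \<Sum>j\<in>Jh h. \<Sum>k\<in>Jh h. w h j k - real L * 2 ^ s)"
    unfolding J_split sum_subtractf[symmetric]
  proof (intro sum_mono)
    fix h j assume "h \<in> {..<G}"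
    then have "real (card (Jh h)) * (real L * 2 ^ s) \<le> real s * (real L * 2 ^ s)"
      using size' by (intro mult_right_mono) auto
    then show "(\<Sum>k\<in>Jh h. w h j k) - real L * 2 ^ s * real s
        \<le> (\<Sum>k\<in>Jh h. w h j k - real L * 2 ^ s)"
      by (simp add: sum_subtractf mult.commute)
  qed
  also have "\<dots> \<le> (\<Sum>h<G. \<Sum>j\<in>Jh h. \<Sum>k\<in>Jh h. real L * real (min (card {i. Y i j k}) (card {i. Y i k j})))"
  proof (intro sum_mono)
    fix h j k assume "j \<in> Jh h" "k \<in> Jh h"
    then have "j \<in> J" "k \<in> J" "c j = c k" "h = c j" by (auto simp: Jh_def)
    then show "w h j k - real L * 2 ^ s
        \<le> real L * real (min (card {i. Y i j k}) (card {i. Y i k j}))" using min_ge by simp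
  qed
  also have "\<dots> \<le> (\<Sum>h<G. \<Sum>j\<in>Jh h. \<Sum>k\<in>J. real L * real (min (card {i. Y i j k}) (card {i. Y i k j})))"
    using fin by (intro sum_mono sum_mono2) (auto simp: Jh_def)
  also have "\<dots> = (\<Sum>j\<in>J. \<Sum>k\<in>J. real L * real (min (card {i. Y i j k}) (card {i. Y i k j})))"
    by (rule J_split[symmetric])
  also have "\<dots> = real L * real (\<Sum>j\<in>J. \<Sum>k\<in>J. min (card {i. Y i j k}) (card {i. Y i k j}))"
    by (simp add: sum_distrib_left)
  also have "\<dots> = 2 * real L * real (card Q)" unfolding Q(2)[symmetric] by simp
  finally show ?thesis using Q(1) unfolding \<tau>_def Jh_def by blast
qed

lemma ex_four_cycle_packing:
  "\<exists>M. \<forall>(I :: 'a set) (J :: 'b::linorder set) P. finite I \<longrightarrow> finite J \<longrightarrow> balanced I J P \<longrightarrow>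
     M \<le> card I \<longrightarrow> M \<le> card J \<longrightarrow>
     (\<exists>Q. four_cycle_packing I J P Q \<and> 3 / 20 * real (card I) * real (card J) \<le> real (card Q))"
proof -
  \<comment> \<open>There are \<open>G\<close> groups of average size \<open>N\<close> between \<open>1000\<close> and \<open>1001\<close>, so that \<open>s\<close> is at least
      \<open>N + 2\<close>. The colour number \<open>L = 600\<close> makes a row good if its imbalance in a group is at most
      \<open>2 L - s = 197\<close>.\<close>
  define s :: nat where "s = 1003"
  define C :: real where "C = 600 * 2 ^ s * real s"
  obtain M0 :: nat where M0: "C \<le> real M0" using real_arch_simple by blast
  define M where "M = max M0 1000000"
  have "\<exists>Q. four_cycle_packing I J P Q \<and> 3 / 20 * real (card I) * real (card J) \<le> real (card Q)"
    if fin: "finite I" "finite J" and bal: "balanced I J P" and M: "M \<le> card I" "M \<le> card J"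
    for I :: "'a set" and J :: "'b set" and P
  proof -
    define m n where "m = real (card I)" and "n = real (card J)"
    define G where "G = card J div 1000"
    define N where "N = n / real G"
    have mn: "m \<ge> 1000000" "n \<ge> 1000000" "m \<ge> C"
      using M M0 by (auto simp: m_def n_def M_def)
    have G: "G \<ge> 1000" using M by (auto simp: G_def M_def)
    have "1000 * G \<le> card J" "card J \<le> 1000 * G + 999" by (auto simp: G_def)
    then have "1000 * real G \<le> n" "n \<le> 1000 * real G + 999" unfolding n_def by linarith+
    then have N: "N \<ge> 1000" "N \<le> 1001" using G by (auto simp: N_def field_simps)
    define u where "u = sgn_entry P"
    have usq: "u i j * u i j = 1" for i j by (simp add: u_def sgn_entry_def)
    \<comment> \<open>The inner product of two columns measures their contribution to the imbalances of the rows;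
        the summand \<open>m\<close> keeps the group sizes balanced as well.\<close>
    define B where "B j k = (\<Sum>i\<in>I. u i j * u i k) + m" for j k
    have "\<exists>c. c ` J \<subseteq> {..<G} \<and>
        (\<forall>j\<in>J. (\<Sum>k\<in>{k \<in> J. c k = c j}. B j k) \<le> 2 * m + m * n / real G)"
    proof (rule ex_balanced_partition)
      show "(\<Sum>k\<in>J. B j k) = m * n" if "j \<in> J" for j
      proof -
        have "(\<Sum>k\<in>J. B j k) = (\<Sum>i\<in>I. \<Sum>k\<in>J. u i j * u i k) + m * n"
          unfolding B_def sum.distrib by (subst sum.swap) (simp add: n_def)
        also have "(\<Sum>i\<in>I. \<Sum>k\<in>J. u i j * u i k) = 0"
          using bal by (simp add: sum_distrib_left[symmetric] balanced_def u_def)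
        finally show ?thesis by simp
      qed
    qed (use fin G mn in \<open>auto simp: B_def usq m_def mult.commute\<close>)
    then obtain c where c: "c ` J \<subseteq> {..<G}"
      and cB: "\<And>j. j \<in> J \<Longrightarrow> (\<Sum>k\<in>{k \<in> J. c k = c j}. B j k) \<le> 2 * m + m * N"
      by (auto simp: N_def)
    define Jh where "Jh h = {j \<in> J. c j = h}" for h
    define k where "k h = real (card (Jh h))" for h
    define D where "D i h = (\<Sum>j\<in>Jh h. u i j)" for i h
    have D_bound: "(\<Sum>i\<in>I. (D i h)\<^sup>2) + m * (k h)\<^sup>2 \<le> k h * (2 * m + m * N)" for h
    proof -
      have "(\<Sum>i\<in>I. (D i h)\<^sup>2) = (\<Sum>i\<in>I. \<Sum>j\<in>Jh h. \<Sum>l\<in>Jh h. u i j * u i l)"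
        by (simp add: D_def power2_eq_square sum_product)
      also have "\<dots> = (\<Sum>j\<in>Jh h. \<Sum>i\<in>I. \<Sum>l\<in>Jh h. u i j * u i l)" by (rule sum.swap)
      also have "\<dots> = (\<Sum>j\<in>Jh h. \<Sum>l\<in>Jh h. \<Sum>i\<in>I. u i j * u i l)"
        by (intro sum.cong refl sum.swap)
      finally have "(\<Sum>i\<in>I. (D i h)\<^sup>2) + m * (k h)\<^sup>2 = (\<Sum>j\<in>Jh h. \<Sum>l\<in>Jh h. B j l)"
        by (simp add: B_def sum.distrib k_def power2_eq_square)
      also have "\<dots> \<le> (\<Sum>j\<in>Jh h. 2 * m + m * N)"
        by (intro sum_mono) (use cB in \<open>auto simp: Jh_def\<close>)
      finally show ?thesis by (simp add: k_def)
    qed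
    have k_bound: "card (Jh h) \<le> s" for h
    proof (rule ccontr)
      assume "\<not> card (Jh h) \<le> s"
      then have k: "k h > 1003" by (simp add: k_def s_def)
      have "0 \<le> (\<Sum>i\<in>I. (D i h)\<^sup>2)" by (simp add: sum_nonneg)
      then have "(m * k h) * k h \<le> (m * k h) * (2 + N)"
        using D_bound[of h] by (simp add: power2_eq_square algebra_simps)
      moreover have "m * k h > 0" using k mn by simp
      ultimately have "k h \<le> 2 + N" by (simp only: mult_le_cancel_left_pos)
      then show False using k N by simp
    qed
    define \<gamma> where "\<gamma> = (1 / 4 + (real s)\<^sup>2 / (2 * (2 * real 600 - real s)\<^sup>2) :: real)"
    have \<gamma>: "0 \<le> \<gamma>" "\<gamma> \<le> 27 / 2" by (simp_all add: \<gamma>_def s_def power2_eq_square)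
    obtain Q where Q: "four_cycle_packing I J P Q"
      "(\<Sum>h<G. \<Sum>i\<in>I. (k h)\<^sup>2 / 4 - \<gamma> * (D i h)\<^sup>2) - real 600 * 2 ^ s * real s * n
         \<le> 2 * real 600 * real (card Q)"
      using four_cycle_packing_of_partition[OF fin bal c, of s 600] k_bound
      unfolding \<gamma>_def k_def D_def u_def n_def Jh_def by (auto simp: s_def simp del: of_nat_numeral)
    have sumk: "(\<Sum>h<G. k h) = n"
    proof -
      have "(\<Sum>h<G. \<Sum>j\<in>Jh h. 1 :: real) = (\<Sum>j\<in>J. 1)"
        unfolding Jh_def by (rule sum.group) (use fin c in auto)
      then show ?thesis by (simp add: k_def n_def)
    qed
    \<comment> \<open>The linear lower bound \<open>2 N k - N\<^sup>2\<close> for \<open>k\<^sup>2\<close> can be summed over the groups.\<close>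
    have "m * n * (N / 4 - 2 * \<gamma>) = (\<Sum>h<G. m * ((1 / 4 + \<gamma>) * (2 * N * k h - N\<^sup>2) - \<gamma> * (2 + N) * k h))"
    proof -
      have "(\<Sum>h<G. m * ((1 / 4 + \<gamma>) * (2 * N * k h - N\<^sup>2) - \<gamma> * (2 + N) * k h))
          = m * ((1 / 4 + \<gamma>) * (2 * N * n - real G * N\<^sup>2) - \<gamma> * (2 + N) * n)"
        by (simp add: sum_distrib_left[symmetric] sum_subtractf sumk)
      also have "real G * N\<^sup>2 = n * N" using G by (simp add: N_def power2_eq_square)
      finally show ?thesis by (simp add: algebra_simps)
    qed
    also have "\<dots> \<le> (\<Sum>h<G. \<Sum>i\<in>I. (k h)\<^sup>2 / 4 - \<gamma> * (D i h)\<^sup>2)"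
    proof (rule sum_mono)
      fix h
      have "0 \<le> (k h - N)\<^sup>2" by simp
      then have "2 * N * k h - N\<^sup>2 \<le> (k h)\<^sup>2" by (simp add: power2_diff algebra_simps)
      then have "(1 / 4 + \<gamma>) * (2 * N * k h - N\<^sup>2) \<le> (1 / 4 + \<gamma>) * (k h)\<^sup>2"
        using \<gamma> by (intro mult_left_mono) auto
      then have "m * ((1 / 4 + \<gamma>) * (2 * N * k h - N\<^sup>2) - \<gamma> * (2 + N) * k h)
          \<le> m * ((1 / 4 + \<gamma>) * (k h)\<^sup>2 - \<gamma> * (2 + N) * k h)"
        using mn by (intro mult_left_mono) auto
      also have "\<dots> = m * (k h)\<^sup>2 / 4 - \<gamma> * (k h * (2 * m + m * N) - m * (k h)\<^sup>2)"
        by (simp add: algebra_simps)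
      also have "\<dots> \<le> m * (k h)\<^sup>2 / 4 - \<gamma> * (\<Sum>i\<in>I. (D i h)\<^sup>2)"
        using D_bound[of h] \<gamma>(1) by (intro diff_left_mono mult_left_mono) auto
      also have "\<dots> = (\<Sum>i\<in>I. (k h)\<^sup>2 / 4 - \<gamma> * (D i h)\<^sup>2)"
        by (simp add: sum_subtractf sum_distrib_left m_def)
      finally show "m * ((1 / 4 + \<gamma>) * (2 * N * k h - N\<^sup>2) - \<gamma> * (2 + N) * k h)
          \<le> (\<Sum>i\<in>I. (k h)\<^sup>2 / 4 - \<gamma> * (D i h)\<^sup>2)" .
    qed
    finally have main: "m * n * (N / 4 - 2 * \<gamma>) - C * n \<le> 1200 * real (card Q)"
      using Q(2) by (simp add: C_def)
    have "m * n * 223 \<le> m * n * (N / 4 - 2 * \<gamma>)"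
      using mn N \<gamma> by (intro mult_left_mono) auto
    moreover have "C * n \<le> m * n" using mn by (intro mult_right_mono) auto
    moreover have "0 \<le> m * n" using mn by simp
    ultimately have "3 / 20 * (m * n) \<le> real (card Q)" using main by linarith
    then show ?thesis using Q(1) unfolding m_def n_def by (auto simp: mult.assoc)
  qed
  then show ?thesis by blast
qed

section \<open>Interchanges and the number of differences\<close>

abbreviation has_one :: "nat mat \<Rightarrow> nat \<Rightarrow> nat \<Rightarrow> bool" where
  "has_one A i j \<equiv> A $$ (i, j) = 1"

text \<open>The positions at which two matrices differ; the range of positions is that of the first one.\<close>

definition differences :: "nat mat \<Rightarrow> nat mat \<Rightarrow> (nat \<times> nat) set" where
  "differences A B = {p \<in> {..<dim_row A} \<times> {..<dim_col A}. A $$ p \<noteq> B $$ p}"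

text \<open>All entries of the submatrix \<open>q\<close> are exchanged between zero and one.\<close>

definition flip :: "nat mat \<Rightarrow> nat \<times> nat \<times> nat \<times> nat \<Rightarrow> nat mat" where
  "flip A q = mat (dim_row A) (dim_col A) (\<lambda>p. if p \<in> cells q then 1 - A $$ p else A $$ p)"

lemma matrix_class_dim:
  assumes "A \<in> matrix_class R S"
  shows "dim_row A = dim_vec R" "dim_col A = dim_vec S"
  using assms by (auto simp: matrix_class_def)

lemma matrix_class_entry:
  assumes "A \<in> matrix_class R S" "i < dim_vec R" "j < dim_vec S"
  shows "A $$ (i, j) = 0 \<or> A $$ (i, j) = 1"
  using assms elements_matI[of A "dim_vec R" "dim_vec S" i j "A $$ (i, j)"]
  by (auto simp: matrix_class_def)

lemma finite_differences [simp]: "finite (differences A B)"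
  unfolding differences_def by (rule finite_subset[of _ "{..<dim_row A} \<times> {..<dim_col A}"]) auto

lemma differences_commute:
  assumes "A \<in> matrix_class R S" "B \<in> matrix_class R S"
  shows "differences A B = differences B A"
  using matrix_class_dim[OF assms(1)] matrix_class_dim[OF assms(2)] by (auto simp: differences_def)

lemma differences_empty_iff:
  assumes "A \<in> matrix_class R S" "B \<in> matrix_class R S"
  shows "differences A B = {} \<longleftrightarrow> A = B"
  using matrix_class_dim[OF assms(1)] matrix_class_dim[OF assms(2)]
  by (auto simp: differences_def intro!: eq_matI)

lemma sum_swap_two:
  fixes f :: "'c \<Rightarrow> nat"
  assumes "finite K" "a \<in> K" "b \<in> K" "a \<noteq> b" "f a + f b = 1"
  shows "(\<Sum>k\<in>K. if k = a \<or> k = b then 1 - f k else f k) = (\<Sum>k\<in>K. f k)"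
proof -
  have K: "K = insert a (insert b (K - {a, b}))" using assms by auto
  have "(\<Sum>k\<in>K - {a, b}. if k = a \<or> k = b then 1 - f k else f k) = (\<Sum>k\<in>K - {a, b}. f k)"
    by (intro sum.cong) auto
  then show ?thesis using assms by (subst (1 2) K) auto
qed

lemma flip_in_matrix_class:
  assumes A: "A \<in> matrix_class R S" and q: "four_cycle (has_one A) q"
    and sub: "cells q \<subseteq> {..<dim_vec R} \<times> {..<dim_vec S}"
  shows "flip A q \<in> matrix_class R S"
proof -
  obtain i i' j j' where qq: "q = (i, i', j, j')" by (cases q)
  have bnd: "i < dim_vec R" "i' < dim_vec R" "j < dim_vec S" "j' < dim_vec S"
    using sub by (auto simp: qq)
  have dim: "dim_row A = dim_vec R" "dim_col A = dim_vec S" using matrix_class_dim[OF A] by auto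
  have ent: "A $$ (i, j) = 1" "A $$ (i, j') = 0" "A $$ (i', j) = 0" "A $$ (i', j') = 1"
    using q matrix_class_entry[OF A] bnd by (auto simp: qq)
  have ne: "i \<noteq> i'" "j \<noteq> j'" using ent by auto
  have flip: "flip A q $$ (a, b) = (if (a = i \<or> a = i') \<and> (b = j \<or> b = j') then 1 - A $$ (a, b) else A $$ (a, b))"
    if "a < dim_vec R" "b < dim_vec S" for a b
    using that dim by (auto simp: flip_def qq)
  have "(\<Sum>b<dim_vec S. flip A q $$ (a, b)) = R $ a" if a: "a < dim_vec R" for a
  proof -
    have "(\<Sum>b<dim_vec S. flip A q $$ (a, b)) = (\<Sum>b<dim_vec S. A $$ (a, b))"
    proof (cases "a = i \<or> a = i'")
      case True
      then have "(\<Sum>b<dim_vec S. flip A q $$ (a, b))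
          = (\<Sum>b<dim_vec S. if b = j \<or> b = j' then 1 - A $$ (a, b) else A $$ (a, b))"
        using a flip by (intro sum.cong) auto
      also have "\<dots> = (\<Sum>b<dim_vec S. A $$ (a, b))"
        using True bnd ne ent by (intro sum_swap_two) auto
      finally show ?thesis .
    qed (use a flip in auto)
    then show ?thesis using A a by (auto simp: matrix_class_def)
  qed
  moreover have "(\<Sum>a<dim_vec R. flip A q $$ (a, b)) = S $ b" if b: "b < dim_vec S" for b
  proof -
    have "(\<Sum>a<dim_vec R. flip A q $$ (a, b)) = (\<Sum>a<dim_vec R. A $$ (a, b))"
    proof (cases "b = j \<or> b = j'")
      case True
      then have "(\<Sum>a<dim_vec R. flip A q $$ (a, b))
          = (\<Sum>a<dim_vec R. if a = i \<or> a = i' then 1 - A $$ (a, b) else A $$ (a, b))"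
        using b flip by (intro sum.cong) auto
      also have "\<dots> = (\<Sum>a<dim_vec R. A $$ (a, b))"
        using True bnd ne ent by (intro sum_swap_two) auto
      finally show ?thesis .
    qed (use b flip in auto)
    then show ?thesis using A b by (auto simp: matrix_class_def)
  qed
  moreover have car: "flip A q \<in> carrier_mat (dim_vec R) (dim_vec S)"
    unfolding flip_def dim by (rule mat_carrier)
  moreover have "elements_mat (flip A q) \<subseteq> {0, 1}"
  proof
    fix x assume "x \<in> elements_mat (flip A q)"
    then have "\<exists>a b. a < dim_vec R \<and> b < dim_vec S \<and> x = flip A q $$ (a, b)"
      unfolding carrier_matD[OF car, symmetric] by (rule elements_matD)
    then obtain a b where ab: "a < dim_vec R" "b < dim_vec S" "x = flip A q $$ (a, b)" by blast
    have "A $$ (a, b) = 0 \<or> A $$ (a, b) = 1" using A ab(1,2) by (rule matrix_class_entry)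
    then show "x \<in> {0, 1}" unfolding ab(3) flip[OF ab(1,2)] by auto
  qed
  ultimately show ?thesis by (simp add: matrix_class_def)
qed

lemma interchange_flip:
  assumes A: "A \<in> matrix_class R S" and q: "four_cycle (has_one A) q"
    and sub: "cells q \<subseteq> {..<dim_vec R} \<times> {..<dim_vec S}"
  shows "interchange A (flip A q) \<or> interchange (flip A q) A"
proof -
  have ordered: "interchange A (flip A (i, i', j, j')) \<or> interchange (flip A (i, i', j, j')) A"
    if lt: "i < i'" and q: "four_cycle (has_one A) (i, i', j, j')"
      and bnd: "i' < dim_vec R" "j < dim_vec S" "j' < dim_vec S" for i i' j j'
  proof -
    have dim: "dim_row A = dim_vec R" "dim_col A = dim_vec S" using matrix_class_dim[OF A] by auto
    have ent: "A $$ (i, j) = 1" "A $$ (i, j') = 0" "A $$ (i', j) = 0" "A $$ (i', j') = 1"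
      using q matrix_class_entry[OF A] bnd less_trans[OF lt bnd(1)] by auto
    let ?F = "flip A (i, i', j, j')"
    consider "j < j'" | "j' < j" using ent by fastforce
    then show ?thesis
    proof cases
      case 1
      have "interchange A ?F" unfolding interchange_def
      proof (intro exI conjI)
        show "?F = mat (dim_row A) (dim_col A) (\<lambda>(p, q).
             if (p, q) \<in> {(i, j), (i', j')} then 0
             else if (p, q) \<in> {(i, j'), (i', j)} then 1 else A $$ (p, q))"
          using ent by (intro eq_matI) (auto simp: flip_def)
      qed (use 1 lt bnd dim ent in auto)
      then show ?thesis ..
    next
      case 2
      have "interchange ?F A" unfolding interchange_def
      proof (intro exI conjI)
        show "A = mat (dim_row ?F) (dim_col ?F) (\<lambda>(p, q).
             if (p, q) \<in> {(i, j'), (i', j)} then 0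
             else if (p, q) \<in> {(i, j), (i', j')} then 1 else ?F $$ (p, q))"
          using ent by (intro eq_matI) (auto simp: flip_def)
      qed (use 2 lt bnd dim ent in \<open>auto simp: flip_def\<close>)
      then show ?thesis ..
    qed
  qed
  obtain i i' j j' where qq: "q = (i, i', j, j')" by (cases q)
  have bnd: "i < dim_vec R" "i' < dim_vec R" "j < dim_vec S" "j' < dim_vec S"
    using sub by (auto simp: qq)
  consider "i < i'" | "i' < i" using q by (fastforce simp: qq)
  then show ?thesis
  proof cases
    case 1
    then show ?thesis using ordered[OF 1] q bnd by (simp add: qq)
  next
    case 2
    \<comment> \<open>Listing both rows and both columns in reverse order gives the same submatrix.\<close>
    have "flip A q = flip A (i', i, j', j)" by (simp add: flip_def qq insert_commute)
    then show ?thesis using ordered[OF 2, of j' j] q bnd by (simp add: qq)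
  qed
qed

section \<open>Walks in the interchange graph\<close>

text \<open>The adjacency relation of the interchange graph.\<close>

definition interchange_rel :: "nat vec \<Rightarrow> nat vec \<Rightarrow> (nat mat \<times> nat mat) set" where
  "interchange_rel R S = parcs (interchange_graph R S)"

lemma interchange_rel_sym: "(A, B) \<in> interchange_rel R S \<Longrightarrow> (B, A) \<in> interchange_rel R S"
  by (auto simp: interchange_rel_def interchange_graph_def)

lemma flip_interchange_rel:
  assumes "A \<in> matrix_class R S" "four_cycle (has_one A) q"
    "cells q \<subseteq> {..<dim_vec R} \<times> {..<dim_vec S}"
  shows "(A, flip A q) \<in> interchange_rel R S"
  using assms interchange_flip[OF assms] flip_in_matrix_class[OF assms]
  by (auto simp: interchange_rel_def interchange_graph_def)

lemma differences_flip:
  assumes A: "A \<in> matrix_class R S" and B: "B \<in> matrix_class R S"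
    and sub: "cells q \<subseteq> {..<dim_vec R} \<times> {..<dim_vec S}"
  shows "differences (flip A q) B = (differences A B - cells q) \<union> (cells q - differences A B)"
proof -
  have dim: "dim_row A = dim_vec R" "dim_col A = dim_vec S" using matrix_class_dim[OF A] by auto
  have "p \<in> differences (flip A q) B \<longleftrightarrow>
      p \<in> (differences A B - cells q) \<union> (cells q - differences A B)" for p
  proof (cases "p \<in> {..<dim_vec R} \<times> {..<dim_vec S}")
    case True
    then have "A $$ p = 0 \<or> A $$ p = 1" "B $$ p = 0 \<or> B $$ p = 1"
      using matrix_class_entry[OF A] matrix_class_entry[OF B] by auto
    moreover have "flip A q $$ p = (if p \<in> cells q then 1 - A $$ p else A $$ p)"
      using True dim by (auto simp: flip_def)
    ultimately show ?thesis using True dim by (auto simp: differences_def flip_def)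
  next
    case False
    then show ?thesis using sub dim by (auto simp: differences_def flip_def)
  qed
  then show ?thesis by blast
qed

lemma card_Diff_Un_Diff_le:
  assumes "finite D" "finite C" "card C \<le> 4" "3 \<le> card (C \<inter> D)"
  shows "card ((D - C) \<union> (C - D)) + 2 \<le> card D"
proof -
  have "card ((D - C) \<union> (C - D)) \<le> card (D - C) + card (C - D)" by (rule card_Un_le)
  moreover have "card (D - C) + card (C \<inter> D) = card D"
    using card_Diff_subset_Int[of D C] card_mono[of D "C \<inter> D"] assms by (simp add: Int_commute)
  moreover have "card (C - D) + card (C \<inter> D) = card C"
    using card_Diff_subset_Int[of C D] card_mono[of C "C \<inter> D"] assms by simp
  ultimately show ?thesis using assms by linarith
qed

lemma card_cells_le: "card (cells q) \<le> 4"
proof -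
  obtain i i' j j' where "q = (i, i', j, j')" by (cases q)
  moreover have "card {i, i'} * card {j, j'} \<le> 2 * 2"
    by (intro mult_le_mono) (auto simp: card_insert_if)
  ultimately show ?thesis by (simp only: cells.simps card_cartesian_product)
qed

lemma finite_cells [simp]: "finite (cells q)"
  by (cases q) simp

lemma card_cells:
  assumes "four_cycle P q"
  shows "card (cells q) = 4"
proof -
  obtain i i' j j' where qq: "q = (i, i', j, j')" by (cases q)
  then have "i \<noteq> i'" "j \<noteq> j'" using assms by auto
  then show ?thesis unfolding qq cells.simps card_cartesian_product by simp
qed

lemma ex_less_if_sum_eq:
  fixes f g :: "'c \<Rightarrow> nat"
  assumes "finite K" "(\<Sum>k\<in>K. f k) = (\<Sum>k\<in>K. g k)" "k \<in> K" "g k < f k"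
  shows "\<exists>l\<in>K. f l < g l"
proof (rule ccontr)
  assume "\<not> ?thesis"
  then have "\<forall>l\<in>K. g l \<le> f l" by (auto simp: not_less)
  then have "(\<Sum>k\<in>K. g k) < (\<Sum>k\<in>K. f k)"
    using assms by (intro sum_strict_mono_ex1) auto
  then show False using assms by simp
qed

lemma flip_reduces_differences:
  assumes A: "A \<in> matrix_class R S" and B: "B \<in> matrix_class R S"
    and sub: "cells (i, i', j, j') \<subseteq> {..<dim_vec R} \<times> {..<dim_vec S}"
    and q: "four_cycle P (i, i', j, j')"
    and D: "{x, y, z} \<subseteq> cells (i, i', j, j') \<inter> differences A B" "x \<noteq> y" "x \<noteq> z" "y \<noteq> z"
  shows "card (differences (flip A (i, i', j, j')) B) + 2 \<le> card (differences A B)"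
proof -
  have "card {x, y, z} \<le> card (cells (i, i', j, j') \<inter> differences A B)"
    using D(1) by (intro card_mono) auto
  moreover have "card {x, y, z} = 3" using D(2-) by simp
  ultimately show ?thesis
    unfolding differences_flip[OF A B sub]
    by (intro card_Diff_Un_Diff_le) (auto intro: card_cells_le simp del: cells.simps)
qed

text \<open>
  Ryser's theorem, with a bound on the number of interchanges. If no interchange in \<open>A\<close> or in \<open>B\<close>
  reduces the number of differences, then following a column from a row where \<open>A\<close> has a zero and \<open>B\<close>
  a one to a row where \<open>A\<close> has a one and \<open>B\<close> a zero leads to a row with a strictly larger set of
  columns where \<open>A\<close> exceeds \<open>B\<close>. This is impossible when the set of the first row has maximal size.
\<close>

lemma ex_reducing_interchange:
  assumes A: "A \<in> matrix_class R S" and B: "B \<in> matrix_class R S" and "A \<noteq> B"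
  shows "\<exists>C. C \<in> matrix_class R S \<and>
    ((A, C) \<in> interchange_rel R S \<and> card (differences C B) + 2 \<le> card (differences A B) \<or>
     (C, B) \<in> interchange_rel R S \<and> card (differences A C) + 2 \<le> card (differences A B))"
proof (rule ccontr)
  assume none: "\<not> ?thesis"
  let ?m = "dim_vec R" and ?n = "dim_vec S"
  note dim = matrix_class_dim[OF A]
  note entA = matrix_class_entry[OF A] and entB = matrix_class_entry[OF B]
  have row: "(\<Sum>j<?n. A $$ (i, j)) = (\<Sum>j<?n. B $$ (i, j))" if "i < ?m" for i
    using A B that by (auto simp: matrix_class_def)
  have col: "(\<Sum>i<?m. A $$ (i, j)) = (\<Sum>i<?m. B $$ (i, j))" if "j < ?n" for j
    using A B that by (auto simp: matrix_class_def)
  define excess where "excess i = {j. j < ?n \<and> B $$ (i, j) < A $$ (i, j)}" for i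
  define rows where "rows = {i. i < ?m \<and> (\<exists>j<?n. A $$ (i, j) < B $$ (i, j))}"
  have "rows \<noteq> {}"
  proof -
    have "differences A B \<noteq> {}" using \<open>A \<noteq> B\<close> differences_empty_iff[OF A B] by simp
    then obtain i j where ij: "i < ?m" "j < ?n" "A $$ (i, j) \<noteq> B $$ (i, j)"
      using dim by (auto simp: differences_def)
    then consider "A $$ (i, j) < B $$ (i, j)" | "B $$ (i, j) < A $$ (i, j)" by linarith
    then have "\<exists>j<?n. A $$ (i, j) < B $$ (i, j)"
    proof cases
      case 2
      then show ?thesis using ex_less_if_sum_eq[OF _ row[OF ij(1)], of j] ij by auto
    qed (use ij in auto)
    then show ?thesis using ij by (auto simp: rows_def)
  qed
  moreover have "finite rows" by (simp add: rows_def)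
  ultimately have "Max ((\<lambda>i. card (excess i)) ` rows) \<in> (\<lambda>i. card (excess i)) ` rows"
    by (intro Max_in) auto
  then obtain i where i: "i \<in> rows" "card (excess i) = Max ((\<lambda>i. card (excess i)) ` rows)"
    by (auto simp del: Max_in)
  have max: "card (excess r) \<le> card (excess i)" if "r \<in> rows" for r
    unfolding i(2) using \<open>finite rows\<close> that by (intro Max_ge) auto
  obtain j' where j': "i < ?m" "j' < ?n" "A $$ (i, j') < B $$ (i, j')" using i by (auto simp: rows_def)
  obtain i' where i': "i' < ?m" "B $$ (i', j') < A $$ (i', j')"
    using ex_less_if_sum_eq[OF _ col[OF j'(2), symmetric], of i] j' by auto
  have in_rows: "i' \<in> rows"
    using ex_less_if_sum_eq[OF _ row[OF i'(1)], of j'] i' j' by (auto simp: rows_def)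
  have "excess i \<subset> excess i'"
  proof (rule psubsetI)
    show "excess i \<subseteq> excess i'"
    proof
      fix j assume "j \<in> excess i"
      then have j: "j < ?n" "B $$ (i, j) < A $$ (i, j)" by (auto simp: excess_def)
      have ent: "A $$ (i, j) = 1" "B $$ (i, j) = 0" "A $$ (i, j') = 0" "B $$ (i, j') = 1"
        "A $$ (i', j') = 1" "B $$ (i', j') = 0"
        using j j' i' entA[of i j] entB[of i j] entA[of i j'] entB[of i j']
          entA[of i' j'] entB[of i' j'] by auto
      have ne: "i \<noteq> i'" "j \<noteq> j'" using ent by auto
      have D: "{(i, j), (i, j'), (i', j')} \<subseteq> differences A B"
        using ent dim j j' i' by (auto simp: differences_def)
      have sub: "cells (i, i', j, j') \<subseteq> {..<?m} \<times> {..<?n}"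
        "cells (i, i', j', j) \<subseteq> {..<?m} \<times> {..<?n}" using j j' i' by auto
      have "A $$ (i', j) \<noteq> 0"
      proof
        assume "A $$ (i', j) = 0"
        then have q: "four_cycle (has_one A) (i, i', j, j')" using ent by simp
        have "card (differences (flip A (i, i', j, j')) B) + 2 \<le> card (differences A B)"
          by (rule flip_reduces_differences[OF A B sub(1) q, of "(i, j)" "(i, j')" "(i', j')"])
            (use D ne in auto)
        then show False
          using none flip_in_matrix_class[OF A q sub(1)] flip_interchange_rel[OF A q sub(1)] by blast
      qed
      moreover have "B $$ (i', j) \<noteq> 1"
      proof
        assume "B $$ (i', j) = 1"
        then have q: "four_cycle (has_one B) (i, i', j', j)" using ent by simp
        note F = flip_in_matrix_class[OF B q sub(2)]
        have "card (differences (flip B (i, i', j', j)) A) + 2 \<le> card (differences B A)"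
          by (rule flip_reduces_differences[OF B A sub(2) q, of "(i, j)" "(i, j')" "(i', j')"])
            (use D ne differences_commute[OF A B] in auto)
        then have "card (differences A (flip B (i, i', j', j))) + 2 \<le> card (differences A B)"
          unfolding differences_commute[OF A F] differences_commute[OF A B] .
        then show False
          using none F interchange_rel_sym[OF flip_interchange_rel[OF B q sub(2)]] by blast
      qed
      ultimately show "j \<in> excess i'" using entA[of i' j] entB[of i' j] j i' by (auto simp: excess_def)
    qed
    have "j' \<in> excess i'" "j' \<notin> excess i" using i' j' by (auto simp: excess_def)
    then show "excess i \<noteq> excess i'" by blast
  qed
  then have "card (excess i) < card (excess i')"
    by (rule psubset_card_mono[rotated]) (simp add: excess_def)
  then show False using max[OF in_rows] by simp
qed

lemma relpow_interchange_rel_le: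
  assumes "A \<in> matrix_class R S" "B \<in> matrix_class R S"
  shows "\<exists>k. (A, B) \<in> interchange_rel R S ^^ k \<and> 2 * k \<le> card (differences A B)"
  using assms
proof (induction "card (differences A B)" arbitrary: A B rule: less_induct)
  case less
  show ?case
  proof (cases "A = B")
    case True
    then show ?thesis by (intro exI[of _ 0]) auto
  next
    case False
    obtain C where C: "C \<in> matrix_class R S" and
      "(A, C) \<in> interchange_rel R S \<and> card (differences C B) + 2 \<le> card (differences A B) \<or>
       (C, B) \<in> interchange_rel R S \<and> card (differences A C) + 2 \<le> card (differences A B)"
      using ex_reducing_interchange[OF less.prems False] by blast
    then consider
      (left) "(A, C) \<in> interchange_rel R S" "card (differences C B) + 2 \<le> card (differences A B)" |
      (right) "(C, B) \<in> interchange_rel R S" "card (differences A C) + 2 \<le> card (differences A B)"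
      by blast
    then show ?thesis
    proof cases
      case left
      then obtain k where "(C, B) \<in> interchange_rel R S ^^ k" "2 * k \<le> card (differences C B)"
        using less.hyps[of C B] less.prems C by auto
      then show ?thesis
        using left relpow_Suc_I2[OF left(1)] by (intro exI[of _ "Suc k"]) (auto simp del: relpow.simps)
    next
      case right
      then obtain k where "(A, C) \<in> interchange_rel R S ^^ k" "2 * k \<le> card (differences A C)"
        using less.hyps[of A C] less.prems C by auto
      then show ?thesis using right by (intro exI[of _ "Suc k"]) auto
    qed
  qed
qed

text \<open>
  One interchange in each 4-cycle removes four differences; the differences that are left cost at most
  one interchange for every two of them.
\<close>

lemma relpow_interchange_rel_of_packing:
  assumes "A \<in> matrix_class R S" "B \<in> matrix_class R S"
    and "four_cycle_packing {..<dim_vec R} {..<dim_vec S} (has_one A) Q"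
    and "\<And>q. q \<in> Q \<Longrightarrow> cells q \<subseteq> differences A B"
  shows "\<exists>k. (A, B) \<in> interchange_rel R S ^^ k \<and> 2 * k + 2 * card Q \<le> card (differences A B)"
proof -
  have "finite Q" using assms(3) by (simp add: four_cycle_packing_def)
  then show ?thesis using assms
  proof (induction Q arbitrary: A rule: finite_induct)
    case empty
    then show ?case using relpow_interchange_rel_le by simp
  next
    case (insert q Q)
    let ?F = "flip A q"
    have q: "four_cycle (has_one A) q" "cells q \<subseteq> {..<dim_vec R} \<times> {..<dim_vec S}"
      and Q: "\<And>r. r \<in> Q \<Longrightarrow> four_cycle (has_one A) r \<and> cells r \<subseteq> {..<dim_vec R} \<times> {..<dim_vec S}"
      and dis: "\<And>r. r \<in> Q \<Longrightarrow> cells q \<inter> cells r = {}" and disQ: "disjoint_family_on cells Q"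
      using insert.prems(3) insert.hyps by (auto simp: four_cycle_packing_def disjoint_family_on_def)
    note F = flip_in_matrix_class[OF insert.prems(1) q]
    have diff: "differences ?F B = differences A B - cells q"
      using differences_flip[OF insert.prems(1,2) q(2)] insert.prems(4)[of q] by auto
    have same: "?F $$ p = A $$ p" if "p \<in> cells r" "r \<in> Q" for p r
    proof -
      have "p \<in> {..<dim_row A} \<times> {..<dim_col A}" "p \<notin> cells q"
        using Q[OF that(2)] dis[OF that(2)] that(1) matrix_class_dim[OF insert.prems(1)] by auto
      then show ?thesis by (auto simp: flip_def)
    qed
    have "four_cycle (has_one ?F) r" if "r \<in> Q" for r
    proof -
      obtain i i' j j' where r: "r = (i, i', j, j')" by (cases r)
      show ?thesis using Q[OF that] same[OF _ that] by (simp add: r)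
    qed
    then have "four_cycle_packing {..<dim_vec R} {..<dim_vec S} (has_one ?F) Q"
      using insert.hyps Q disQ by (simp add: four_cycle_packing_def)
    moreover have "cells r \<subseteq> differences ?F B" if "r \<in> Q" for r
      using that insert.prems(4)[of r] dis[OF that] unfolding diff by auto
    ultimately obtain k where k: "(?F, B) \<in> interchange_rel R S ^^ k"
      "2 * k + 2 * card Q \<le> card (differences ?F B)"
      using insert.IH[OF F insert.prems(2)] by blast
    have "card (differences ?F B) + 4 = card (differences A B)"
    proof -
      have "cells q \<subseteq> differences A B" using insert.prems(4) by simp
      then show ?thesis
        unfolding diff using card_cells[OF q(1)] card_mono[of "differences A B" "cells q"]
        by (simp add: card_Diff_subset)
    qed
    then show ?case
      using k insert.hyps relpow_Suc_I2[OF flip_interchange_rel[OF insert.prems(1) q] k(1)]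
      by (intro exI[of _ "Suc k"]) auto
  qed
qed

lemma wf_interchange_graph: "wf_digraph (with_proj (interchange_graph R S))"
proof -
  interpret pair_graph "interchange_graph R S" by (rule pair_graph_interchange_graph)
  show ?thesis by unfold_locales
qed

lemma interchange_distance_le:
  assumes "(A, B) \<in> interchange_rel R S ^^ k" "B \<in> matrix_class R S"
  shows "interchange_distance R S A B \<le> ereal (real k)"
proof -
  interpret wf_digraph "with_proj (interchange_graph R S)" by (rule wf_interchange_graph)
  have "\<exists>p. awalk A p B \<and> length p = k"
    using assms
  proof (induction k arbitrary: A)
    case 0
    then show ?case by (intro exI[of _ "[]"]) (simp add: awalk_Nil_iff, simp add: interchange_graph_def)
  next
    case (Suc k)
    obtain C where C: "(A, C) \<in> interchange_rel R S" "(C, B) \<in> interchange_rel R S ^^ k"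
      using Suc.prems(1) by (rule relpow_Suc_E2)
    obtain p where "awalk C p B" "length p = k" using Suc.IH[OF C(2) Suc.prems(2)] by blast
    then show ?case
      using C(1) by (intro exI[of _ "(A, C) # p"]) (auto simp: awalk_Cons_iff interchange_rel_def)
  qed
  then obtain p where p: "awalk A p B" "length p = k" by blast
  have "awalk_cost (\<lambda>_. 1) p = real (length p)"
    by (induction p) auto
  then show ?thesis
    using min_cost_le_walk_cost[OF p(1), of "\<lambda>_. 1"] p(2) by (simp add: interchange_distance_def)
qed

lemma card_differences_interchange:
  assumes "interchange A B"
  shows "card (differences A B) \<le> 4"
proof -
  obtain i i' j j' where "i < i'" "i' < dim_row A" "j < j'" "j' < dim_col A" and
    B: "B = mat (dim_row A) (dim_col A) (\<lambda>(p, q).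
             if (p, q) \<in> {(i, j), (i', j')} then 0
             else if (p, q) \<in> {(i, j'), (i', j)} then 1 else A $$ (p, q))"
    using assms unfolding interchange_def by blast
  have "differences A B \<subseteq> cells (i, i', j, j')"
  proof
    fix p assume p: "p \<in> differences A B"
    obtain a b where ab: "p = (a, b)" by (cases p)
    then have "a < dim_row A" "b < dim_col A" "A $$ (a, b) \<noteq> B $$ (a, b)"
      using p by (auto simp: differences_def)
    then have "(a, b) \<in> {(i, j), (i', j')} \<or> (a, b) \<in> {(i, j'), (i', j)}"
      unfolding B by (auto split: if_splits)
    then show "p \<in> cells (i, i', j, j')" by (auto simp: ab)
  qed
  then have "card (differences A B) \<le> card (cells (i, i', j, j'))" by (intro card_mono) auto
  also have "\<dots> \<le> 4" by (rule card_cells_le)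
  finally show ?thesis .
qed

lemma interchange_distance_ge:
  assumes "B \<in> matrix_class R S"
  shows "ereal (real (card (differences A B)) / 4) \<le> interchange_distance R S A B"
proof -
  interpret wf_digraph "with_proj (interchange_graph R S)" by (rule wf_interchange_graph)
  have "card (differences A B) \<le> 4 * length p" if "awalk A p B" for p
    using that
  proof (induction p arbitrary: A)
    case Nil
    then show ?case by (simp add: awalk_Nil_iff differences_def)
  next
    case (Cons e p)
    obtain C where e: "e = (A, C)" "(A, C) \<in> interchange_rel R S" and C: "awalk C p B"
      using Cons.prems by (cases e) (auto simp: awalk_Cons_iff interchange_rel_def)
    have AC: "A \<in> matrix_class R S" "C \<in> matrix_class R S" "interchange A C \<or> interchange C A"
      using e(2) by (auto simp: interchange_rel_def interchange_graph_def)
    have "card (differences A C) \<le> 4"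
      using AC(3) card_differences_interchange differences_commute[OF AC(1,2)] by metis
    moreover have "differences A B \<subseteq> differences A C \<union> differences C B"
      using matrix_class_dim[OF AC(1)] matrix_class_dim[OF AC(2)] by (auto simp: differences_def)
    then have "card (differences A B) \<le> card (differences A C) + card (differences C B)"
      by (intro order.trans[OF card_mono card_Un_le]) auto
    ultimately show ?case using Cons.IH[OF C] by simp
  qed
  moreover have "awalk_cost (\<lambda>_. 1) p = real (length p)" for p :: "(nat mat \<times> nat mat) list"
    by (induction p) auto
  ultimately have "real (card (differences A B)) / 4 \<le> awalk_cost (\<lambda>_. 1) p" if "awalk A p B" for p
    using that by (fastforce simp: field_simps)
  then show ?thesis
    unfolding interchange_distance_def \<mu>_def by (intro INF_greatest) auto
qed


section \<open>Antipodal matrices\<close>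

lemma antipodal_entry:
  assumes "antipodal R S A B" "i < dim_vec R" "j < dim_vec S"
  shows "A $$ (i, j) + B $$ (i, j) = 1"
proof -
  have B: "B \<in> matrix_class R S" and eq: "A + B = mat (dim_vec R) (dim_vec S) (\<lambda>_. 1)"
    using assms(1) by (auto simp: antipodal_def)
  have "(A + B) $$ (i, j) = 1" unfolding eq using assms(2,3) by simp
  then show ?thesis using matrix_class_dim[OF B] assms(2,3) by simp
qed

lemma differences_antipodal:
  assumes "antipodal R S A B"
  shows "differences A B = {..<dim_vec R} \<times> {..<dim_vec S}"
proof -
  have A: "A \<in> matrix_class R S" using assms by (simp add: antipodal_def)
  have "A $$ (i, j) \<noteq> B $$ (i, j)" if "i < dim_vec R" "j < dim_vec S" for i j
    using antipodal_entry[OF assms that] by (metis odd_add odd_one)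
  then show ?thesis using matrix_class_dim[OF A] by (auto simp: differences_def)
qed

lemma balanced_antipodal:
  assumes "antipodal R S A B"
  shows "balanced {..<dim_vec R} {..<dim_vec S} (has_one A)"
proof -
  have A: "A \<in> matrix_class R S" and B: "B \<in> matrix_class R S"
    using assms by (auto simp: antipodal_def)
  have sgn: "sgn_entry (has_one A) i j = real (A $$ (i, j)) - real (B $$ (i, j))"
    if "i < dim_vec R" "j < dim_vec S" for i j
    using antipodal_entry[OF assms that] matrix_class_entry[OF A that] by (auto simp: sgn_entry_def)
  have "(\<Sum>j<dim_vec S. sgn_entry (has_one A) i j) = 0" if "i < dim_vec R" for i
  proof -
    have "(\<Sum>j<dim_vec S. sgn_entry (has_one A) i j)
        = real (\<Sum>j<dim_vec S. A $$ (i, j)) - real (\<Sum>j<dim_vec S. B $$ (i, j))"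
      using sgn that by (simp add: sum_subtractf)
    moreover have "(\<Sum>j<dim_vec S. A $$ (i, j)) = R $ i" "(\<Sum>j<dim_vec S. B $$ (i, j)) = R $ i"
      using A B that by (auto simp: matrix_class_def)
    ultimately show ?thesis by (simp only: diff_self)
  qed
  moreover have "(\<Sum>i<dim_vec R. sgn_entry (has_one A) i j) = 0" if "j < dim_vec S" for j
  proof -
    have "(\<Sum>i<dim_vec R. sgn_entry (has_one A) i j)
        = real (\<Sum>i<dim_vec R. A $$ (i, j)) - real (\<Sum>i<dim_vec R. B $$ (i, j))"
      using sgn that by (simp add: sum_subtractf)
    moreover have "(\<Sum>i<dim_vec R. A $$ (i, j)) = S $ j" "(\<Sum>i<dim_vec R. B $$ (i, j)) = S $ j"
      using A B that by (auto simp: matrix_class_def)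
    ultimately show ?thesis by (simp only: diff_self)
  qed
  ultimately show ?thesis by (simp add: balanced_def)
qed

lemma antipodal_distance_ge:
  assumes "antipodal R S A B"
  shows "ereal (1 / 4 * real (dim_vec R) * real (dim_vec S)) \<le> interchange_distance R S A B"
proof -
  have "B \<in> matrix_class R S" using assms by (simp add: antipodal_def)
  from interchange_distance_ge[OF this, of A] show ?thesis
    by (simp add: differences_antipodal[OF assms] card_cartesian_product)
qed

lemma antipodal_distance_le:
  "\<exists>M. \<forall>R S A B. antipodal R S A B \<and> min (dim_vec R) (dim_vec S) \<ge> M \<longrightarrow>
     interchange_distance R S A B \<le> ereal (7 / 20 * real (dim_vec R) * real (dim_vec S))"
proof -
  obtain M where M: "\<forall>(I :: nat set) (J :: nat set) P. finite I \<longrightarrow> finite J \<longrightarrow> balanced I J P \<longrightarrow>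
      M \<le> card I \<longrightarrow> M \<le> card J \<longrightarrow>
      (\<exists>Q. four_cycle_packing I J P Q \<and> 3 / 20 * real (card I) * real (card J) \<le> real (card Q))"
    using ex_four_cycle_packing by blast
  have "interchange_distance R S A B \<le> ereal (7 / 20 * real (dim_vec R) * real (dim_vec S))"
    if anti: "antipodal R S A B" and large: "min (dim_vec R) (dim_vec S) \<ge> M" for R S A B
  proof -
    have A: "A \<in> matrix_class R S" and B: "B \<in> matrix_class R S"
      using anti by (auto simp: antipodal_def)
    obtain Q where Q: "four_cycle_packing {..<dim_vec R} {..<dim_vec S} (has_one A) Q"
      "3 / 20 * real (dim_vec R) * real (dim_vec S) \<le> real (card Q)"
      using M[rule_format, OF _ _ balanced_antipodal[OF anti]] large by auto
    have "cells q \<subseteq> differences A B" if "q \<in> Q" for q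
      using Q(1) that unfolding differences_antipodal[OF anti] by (simp add: four_cycle_packing_def)
    then obtain k where k: "(A, B) \<in> interchange_rel R S ^^ k"
      "2 * k + 2 * card Q \<le> card (differences A B)"
      using relpow_interchange_rel_of_packing[OF A B Q(1)] by blast
    have "real (2 * k + 2 * card Q) \<le> real (dim_vec R * dim_vec S)"
      using k(2) unfolding differences_antipodal[OF anti]
      by (simp only: card_cartesian_product card_lessThan of_nat_le_iff)
    then have "real k \<le> 7 / 20 * real (dim_vec R) * real (dim_vec S)"
      using Q(2) by simp
    then show ?thesis
      using interchange_distance_le[OF k(1) B] by (meson ereal_less_eq(3) order.trans)
  qed
  then show ?thesis by blast
qed

theorem corollary1p2:
  shows "(\<forall>R S A B. antipodal R S A B \<longrightarrow>
            ereal (0.25 * real (dim_vec R) * real (dim_vec S)) \<le> interchange_distance R S A B) \<and>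
         (\<forall>\<epsilon>::real. \<epsilon> > 0 \<longrightarrow>
            (\<exists>M::nat. \<forall>R S A B. antipodal R S A B \<and> min (dim_vec R) (dim_vec S) \<ge> M \<longrightarrow>
               interchange_distance R S A B
                 \<le> ereal ((1 + sqrt 2) / (4 + sqrt 8)
                           * real (dim_vec R) * real (dim_vec S) * (1 + \<epsilon>)))) \<and>
         \<bar>(1 + sqrt 2) / (4 + sqrt 8) - (0.354::real)\<bar> < 0.0005"
proof (intro conjI allI impI)
  show "ereal (0.25 * real (dim_vec R) * real (dim_vec S)) \<le> interchange_distance R S A B"
    if "antipodal R S A B" for R S A B
    using antipodal_distance_ge[OF that] by simp
next
  have sqrt8: "sqrt 8 = 2 * sqrt 2" using real_sqrt_mult[of 4 2] by simp
  have sqrt2: "1.414 \<le> sqrt 2" "sqrt 2 \<le> 1.415"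
    by (rule real_le_rsqrt, simp add: power2_eq_square)
      (rule real_le_lsqrt, simp_all add: power2_eq_square)
  have pos: "0 < 4 + 2 * sqrt 2" using sqrt2 by linarith
  show "\<bar>(1 + sqrt 2) / (4 + sqrt 8) - (0.354::real)\<bar> < 0.0005"
  proof -
    have "\<bar>x - 0.354\<bar> < 0.0005" if "0.3535 < x" "x < 0.3545" for x :: real
      using that by (auto simp: abs_if)
    moreover have "0.3535 < (1 + sqrt 2) / (4 + 2 * sqrt 2)"
      unfolding pos_less_divide_eq[OF pos] using sqrt2 by simp
    moreover have "(1 + sqrt 2) / (4 + 2 * sqrt 2) < 0.3545"
      unfolding pos_divide_less_eq[OF pos] using sqrt2 by simp
    ultimately show ?thesis unfolding sqrt8 by blast
  qed
  have const: "7 / 20 \<le> (1 + sqrt 2) / (4 + sqrt 8)"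
    unfolding sqrt8 pos_le_divide_eq[OF pos] using sqrt2 by simp
  obtain M where M: "\<And>R S A B. antipodal R S A B \<Longrightarrow> min (dim_vec R) (dim_vec S) \<ge> M \<Longrightarrow>
      interchange_distance R S A B \<le> ereal (7 / 20 * real (dim_vec R) * real (dim_vec S))"
    using antipodal_distance_le by blast
  fix \<epsilon> :: real assume "\<epsilon> > 0"
  show "\<exists>M::nat. \<forall>R S A B. antipodal R S A B \<and> min (dim_vec R) (dim_vec S) \<ge> M \<longrightarrow>
      interchange_distance R S A B
        \<le> ereal ((1 + sqrt 2) / (4 + sqrt 8) * real (dim_vec R) * real (dim_vec S) * (1 + \<epsilon>))"
  proof (intro exI[of _ M] allI impI)
    fix R S A B assume *: "antipodal R S A B \<and> min (dim_vec R) (dim_vec S) \<ge> M"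
    have "7 / 20 * (real (dim_vec R) * real (dim_vec S)) * 1
        \<le> (1 + sqrt 2) / (4 + sqrt 8) * (real (dim_vec R) * real (dim_vec S)) * (1 + \<epsilon>)"
    proof (rule mult_mono)
      show "7 / 20 * (real (dim_vec R) * real (dim_vec S))
          \<le> (1 + sqrt 2) / (4 + sqrt 8) * (real (dim_vec R) * real (dim_vec S))"
        using const by (rule mult_right_mono) simp
    qed (use \<open>\<epsilon> > 0\<close> in simp_all)
    then have "ereal (7 / 20 * real (dim_vec R) * real (dim_vec S))
        \<le> ereal ((1 + sqrt 2) / (4 + sqrt 8) * real (dim_vec R) * real (dim_vec S) * (1 + \<epsilon>))"
      by (simp only: ereal_less_eq mult.assoc mult_1_right)
    with M[of R S A B] * show "interchange_distance R S A B
        \<le> ereal ((1 + sqrt 2) / (4 + sqrt 8) * real (dim_vec R) * real (dim_vec S) * (1 + \<epsilon>))"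
      by (blast intro: order.trans)
  qed
qed

end
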